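(* Let $0<\lambda<n$ and let $b$ be a measurable function on $\mathbb{R}^n$. The following assertions are equivalent: (i) $b\in \operatorname{BMO}(\mathbb{R}^n)$. (ii) The maximal commutator $C_b$ is bounded from $\mathcal{M}_{L(1+\log^+L),\lambda}$ to $W\mathcal{M}_{L(1+\log^+L),\lambda}$, i.e. there is a constant $c>0$ such that $\|C_b(f)\|_{W\mathcal{M}_{L(1+\log^+L),\lambda}}\le c\,\|f\|_{\mathcal{M}_{L(1+\log^+L),\lambda}}$ for all $f\in\mathcal{M}_{L(1+\log^+L),\lambda}$.
   Context: Cubes in $\mathbb{R}^n$ have sides parallel to the coordinate axes; $\log^+t=\max\{\log t,0\}$; $f_Q=\frac1{|Q|}\int_Q f$. $\operatorname{BMO}(\mathbb{R}^n)$ is the set of locally integrable $f$ with $\|f\|_*:=\sup_Q\frac1{|Q|}\int_Q|f(y)-f_Q|\,dy<\infty$ (supremum over all cubes). Maximal commutator: for measurable $b$, $C_b(f)(x):=\sup_{Q\ni x}\frac1{|Q|}\int_Q|b(x)-b(y)||f(y)|\,dy$, $x\in\mathbb{R}^n$, the supremum being over all cubes $Q$ containing $x$. For a cube $Q$ and measurable $g$: $\|g\|_{L(1+\log^+L),Q}:=\inf\{\alpha>0:\frac1{|Q|}\int_Q\frac{|g(x)|}{\alpha}\left(1+\log^+\frac{|g(x)|}{\alpha}\right)dx\le1\}$, $\|g\|_{WL(1+\log^+L),Q}:=\inf\left\{\alpha>0:\sup_{t>0}\frac1{|Q|}\frac{|\{x\in Q:|g(x)|>\alpha t\}|}{\frac1t\left(1+\log^+\frac1t\right)}\le1\right\}$.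 For $0<\lambda<n$, the Zygmund-Morrey space $\mathcal{M}_{L(1+\log^+L),\lambda}$ (also written $\mathcal M_{L(\log L),\lambda}$) and the weak Zygmund-Morrey space $W\mathcal{M}_{L(1+\log^+L),\lambda}$ consist of the measurable functions $f$ on $\mathbb{R}^n$ for which, respectively, $\|f\|_{\mathcal{M}_{L(1+\log^+L),\lambda}}:=\sup_Q|Q|^{\lambda/n}\|f\|_{L(1+\log^+L),Q}<\infty$ and $\|f\|_{W\mathcal{M}_{L(1+\log^+L),\lambda}}:=\sup_Q|Q|^{\lambda/n}\|f\|_{WL(1+\log^+L),Q}<\infty$ (suprema over all cubes $Q$). *)

theory Defs
  imports "HOL-Analysis.Analysis"
begin

text \<open>
  Averages, norms and maximal functions take values in \<^typ>\<open>ennreal\<close>, so that suprema over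
  cubes and infima over empty sets (equal to infinity) have their usual extended meaning.
  ``Measurable'' means Lebesgue measurable. Cubes are closed and non-degenerate; replacing them
  by open cubes changes none of the quantities below.
\<close>

definition cubes :: "(real ^ 'n) set set" where
  "cubes = {cbox a (a + vec l) | a l. 0 < l}"

definition log_plus :: "real \<Rightarrow> real" where
  "log_plus t = max (ln t) 0"

definition avg :: "(real ^ 'n) set \<Rightarrow> (real ^ 'n \<Rightarrow> ennreal) \<Rightarrow> ennreal" where
  "avg Q h = (\<integral>\<^sup>+ y \<in> Q. h y \<partial>lebesgue) / emeasure lebesgue Q"

definition mean_value :: "(real ^ 'n \<Rightarrow> real) \<Rightarrow> (real ^ 'n) set \<Rightarrow> real" where
  "mean_value f Q = (LINT y:Q|lebesgue. f y) / measure lebesgue Q"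

definition locally_integrable :: "(real ^ 'n \<Rightarrow> real) \<Rightarrow> bool" where
  "locally_integrable f \<longleftrightarrow> (\<forall>K. compact K \<longrightarrow> set_integrable lebesgue K f)"

definition BMO_norm :: "(real ^ 'n \<Rightarrow> real) \<Rightarrow> ennreal" where
  "BMO_norm f = (SUP Q\<in>cubes. avg Q (\<lambda>y. ennreal \<bar>f y - mean_value f Q\<bar>))"

definition BMO :: "(real ^ 'n \<Rightarrow> real) set" where
  "BMO = {f. locally_integrable f \<and> BMO_norm f < \<infinity>}"

definition maximal_commutator ::
    "(real ^ 'n \<Rightarrow> real) \<Rightarrow> (real ^ 'n \<Rightarrow> real) \<Rightarrow> real ^ 'n \<Rightarrow> ennreal" where
  "maximal_commutator b f x =
     (SUP Q\<in>{Q \<in> cubes. x \<in> Q}. avg Q (\<lambda>y. ennreal (\<bar>b x - b y\<bar> * \<bar>f y\<bar>)))"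

definition LlogL_norm :: "(real ^ 'n) set \<Rightarrow> (real ^ 'n \<Rightarrow> real) \<Rightarrow> ennreal" where
  "LlogL_norm Q g =
     (INF \<alpha>\<in>{\<alpha>::real. 0 < \<alpha> \<and>
        avg Q (\<lambda>x. ennreal (\<bar>g x\<bar> / \<alpha> * (1 + log_plus (\<bar>g x\<bar> / \<alpha>)))) \<le> 1}. ennreal \<alpha>)"

text \<open>
  The weak norms are applied to the maximal commutator, which is non-negative and may be infinite
  at some points; they are therefore stated for \<^typ>\<open>ennreal\<close>-valued functions
  (for a real function \<open>g\<close>, pass \<open>\<lambda>x. ennreal \<bar>g x\<bar>\<close>).
\<close>

definition weak_LlogL_norm :: "(real ^ 'n) set \<Rightarrow> (real ^ 'n \<Rightarrow> ennreal) \<Rightarrow> ennreal" where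
  "weak_LlogL_norm Q g =
     (INF \<alpha>\<in>{\<alpha>::real. 0 < \<alpha> \<and>
        (SUP t\<in>{t::real. 0 < t}.
           emeasure lebesgue {x \<in> Q. g x > ennreal (\<alpha> * t)} / emeasure lebesgue Q
             / ennreal (1 / t * (1 + log_plus (1 / t)))) \<le> 1}. ennreal \<alpha>)"

definition zygmund_morrey_norm :: "real \<Rightarrow> (real ^ 'n \<Rightarrow> real) \<Rightarrow> ennreal" where
  "zygmund_morrey_norm lam f =
     (SUP Q\<in>cubes. ennreal (measure lebesgue Q powr (lam / real CARD('n))) * LlogL_norm Q f)"

definition zygmund_morrey :: "real \<Rightarrow> (real ^ 'n \<Rightarrow> real) set" where
  "zygmund_morrey lam = {f \<in> borel_measurable lebesgue. zygmund_morrey_norm lam f < \<infinity>}"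

definition weak_zygmund_morrey_norm :: "real \<Rightarrow> (real ^ 'n \<Rightarrow> ennreal) \<Rightarrow> ennreal" where
  "weak_zygmund_morrey_norm lam g =
     (SUP Q\<in>cubes. ennreal (measure lebesgue Q powr (lam / real CARD('n))) * weak_LlogL_norm Q g)"

definition weak_zygmund_morrey :: "real \<Rightarrow> (real ^ 'n \<Rightarrow> ennreal) set" where
  "weak_zygmund_morrey lam = {g \<in> borel_measurable lebesgue. weak_zygmund_morrey_norm lam g < \<infinity>}"

end

theory Submission
  imports Defs
begin

text \<open>
Write \<open>\<theta> = \<lambda> / n\<close> and \<open>\<Phi>(u) = u (1 + log\<^sup>+ u)\<close>.  In the weak norm only the levels \<open>t > 1\<close>
matter: for \<open>t \<le> 1\<close> the weight \<open>\<Phi>(1/t)\<close> is at least 1, so the condition holds trivially, and for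
\<open>t > 1\<close> the weight is \<open>1/t\<close>.

From the bound on \<open>C\<^sub>b\<close> to BMO, the test functions are indicators of cubes.  The indicator of
\<open>Q\<close> has norm at most \<open>|Q|\<^sup>\<theta> / (1 - \<theta>)\<close> (\<open>zygmund_morrey_norm_indicator_cube\<close>), and on \<open>Q\<close>
its maximal commutator dominates the mean of \<open>|b(x) - b|\<close> over \<open>Q\<close>.  The weak estimate bounds this
mean at one point \<open>x\<close> of \<open>Q\<close>, by a constant independent of \<open>Q\<close>, and one point is enough: \<open>b\<close> then
has bounded mean oscillation about the constants \<open>b(x)\<close>.

From BMO to the bound on \<open>C\<^sub>b\<close>, fix a cube \<open>Q\<^sub>0\<close> and a function \<open>f\<close>, and split the cubes \<open>Q\<close> that
contain a given point \<open>x\<close> of \<open>Q\<^sub>0\<close> by their size.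

If \<open>Q\<close> is larger than \<open>Q\<^sub>0\<close>, then its triple \<open>R\<close> contains \<open>Q\<^sub>0\<close>.  The mean over \<open>Q\<close> is at most
a multiple of \<open>N |R|\<^sup>-\<^sup>\<theta> (|b(x) - b\<^sub>R| + 1)\<close>, where \<open>N\<close> is the norm of \<open>f\<close>.  The difference between
\<open>b\<^sub>R\<close> and the mean of \<open>b\<close> over \<open>Q\<^sub>0\<close> grows only like the logarithm of \<open>|R| / |Q\<^sub>0|\<close>
(\<open>mean_comparison\<close>), so the decay of \<open>|R|\<^sup>-\<^sup>\<theta>\<close> absorbs it, and Chebyshev's inequality on \<open>Q\<^sub>0\<close>
concludes (\<open>large_cube_estimate\<close>).

If \<open>Q\<close> is at most as large as \<open>Q\<^sub>0\<close>, then it lies in the triple of \<open>Q\<^sub>0\<close>, and the mean is at most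
\<open>|b(x) - b\<^sub>Q| |f|\<^sub>Q\<close> plus the mean of \<open>|b - b\<^sub>Q| |f|\<close> over \<open>Q\<close>.  The second term is controlled by
duality between \<open>L log L\<close> and exponential integrability and by the Vitali covering argument.  The
first one is of weak type (1,1): where \<open>|f|\<^sub>Q\<close> is about \<open>2\<^sup>-\<^sup>k s\<close>, a product above \<open>s\<close> forces
\<open>|b(x) - b\<^sub>Q| > 2\<^sup>k\<close>.  Covering loses a factor \<open>2\<^sup>k\<close>, but the square integrability of the
oscillation gains \<open>4\<^sup>-\<^sup>k\<close>, so the levels can be summed (\<open>small_cubes_estimate\<close>).

Both cases rest on the John-Nirenberg inequality (\<open>John_Nirenberg\<close>).  Its proof replaces the
Lebesgue differentiation theorem by outer regularity: a level set is put into an open set of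
comparable measure, and cubes are selected by the density of that open set.  All the covering
arguments are instances of \<open>covering_estimate\<close>; the countability that it asks for comes from
Lindelof's theorem for the stopping cubes of the John-Nirenberg inequality.  For the maximal
commutator it comes from replacing arbitrary cubes by rational ones, which leaves \<open>C\<^sub>b\<close> unchanged
and also shows that \<open>C\<^sub>b f\<close> is measurable.
\<close>

section \<open>Cubes and coverings\<close>

definition cube :: "real ^ 'n \<Rightarrow> real \<Rightarrow> (real ^ 'n) set" where
  "cube a l = cbox a (a + vec l)"

lemma mem_cube: "x \<in> cube a l \<longleftrightarrow> (\<forall>i. a $ i \<le> x $ i \<and> x $ i \<le> a $ i + l)"
  by (simp add: cube_def mem_box_cart)

lemma cubes_eq: "cubes = {cube a l | a l. 0 < l}"
  by (simp add: cubes_def cube_def)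

lemma cube_in_cubes [intro]: "0 < l \<Longrightarrow> cube a l \<in> cubes"
  by (auto simp: cubes_eq)

lemma cube_measurable [measurable, simp]: "cube a l \<in> sets lebesgue"
  by (simp add: cube_def)

lemma measure_cube: "0 \<le> l \<Longrightarrow> measure lebesgue (cube (a :: real ^ 'n) l) = l ^ CARD('n)"
proof -
  assume "0 \<le> l"
  then have "cbox a (a + vec l) \<noteq> {}"
    by (auto simp: interval_ne_empty_cart)
  then show ?thesis
    by (simp add: cube_def content_cbox_cart)
qed

lemma emeasure_cube:
  "0 \<le> l \<Longrightarrow> emeasure lebesgue (cube (a :: real ^ 'n) l) = ennreal (l ^ CARD('n))"
  using measure_cube[of l a] emeasure_eq_measure2[OF lmeasurable_cbox[of a "a + vec l"]]
  by (simp add: cube_def)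

lemma cube_nonempty: "0 \<le> l \<Longrightarrow> a \<in> cube a l"
  by (simp add: mem_cube)

lemma cube_subset_triple:
  assumes "cube a l \<inter> cube a' l' \<noteq> {}" "l \<le> l'"
  shows "cube a l \<subseteq> cube (a' - vec l') (3 * l')"
proof
  fix x assume x: "x \<in> cube a l"
  obtain z where z: "z \<in> cube a l" "z \<in> cube a' l'" using assms by auto
  show "x \<in> cube (a' - vec l') (3 * l')"
    unfolding mem_cube
  proof
    fix i
    show "(a' - vec l') $ i \<le> x $ i \<and> x $ i \<le> (a' - vec l') $ i + 3 * l'"
      using x z assms(2) unfolding mem_cube by (auto dest!: spec[of _ i])
  qed
qed

text \<open>
The greedy selection: a cube of maximal side is kept, and its triple swallows all the remaining
cubes that meet it.  Cubes are indexed, and disjointness is that of the indexed family, so the same cube is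
never selected under two indices.
\<close>

lemma finite_vitali_cubes:
  fixes a :: "'i \<Rightarrow> real ^ 'n"
  assumes "finite I" "\<And>i. i \<in> I \<Longrightarrow> 0 < l i"
  shows "\<exists>T\<subseteq>I. disjoint_family_on (\<lambda>i. cube (a i) (l i)) T \<and>
    (\<forall>i\<in>I. \<exists>j\<in>T. cube (a i) (l i) \<subseteq> cube (a j - vec (l j)) (3 * l j))"
  using assms
proof (induction I rule: finite_psubset_induct)
  case (psubset I)
  show ?case
  proof (cases "I = {}")
    case False
    then have "Max (l ` I) \<in> l ` I"
      using psubset(1) by (intro Max_in) auto
    then obtain j where j: "j \<in> I" "Max (l ` I) = l j"
      by blast
    have jmax: "l i \<le> l j" if "i \<in> I" for i
      using Max_ge[of "l ` I" "l i"] that psubset(1) j(2) by simp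
    define I' where "I' = {i \<in> I. cube (a i) (l i) \<inter> cube (a j) (l j) = {}}"
    have "j \<notin> I'"
      using cube_nonempty[of "l j" "a j"] psubset(3)[OF j(1)] by (auto simp: I'_def)
    then have "I' \<subset> I" using j(1) by (auto simp: I'_def)
    from psubset.IH[OF this] psubset.prems obtain T where T: "T \<subseteq> I'"
      "disjoint_family_on (\<lambda>i. cube (a i) (l i)) T"
      "\<forall>i\<in>I'. \<exists>j\<in>T. cube (a i) (l i) \<subseteq> cube (a j - vec (l j)) (3 * l j)"
      by (metis (no_types, lifting) \<open>I' \<subset> I\<close> psubsetD)
    have "disjoint_family_on (\<lambda>i. cube (a i) (l i)) (insert j T)"
      using T(1,2) unfolding disjoint_family_on_def I'_def by blast
    moreover have "\<exists>k\<in>insert j T. cube (a i) (l i) \<subseteq> cube (a k - vec (l k)) (3 * l k)" if "i \<in> I" for i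
    proof (cases "i \<in> I'")
      case True
      then show ?thesis using T(3) by blast
    next
      case False
      then show ?thesis
        using cube_subset_triple[of "a i" "l i" "a j" "l j"] jmax[OF that] that by (auto simp: I'_def)
    qed
    moreover have "insert j T \<subseteq> I" using T(1) j(1) by (auto simp: I'_def)
    ultimately show ?thesis by blast
  qed (auto simp: disjoint_family_on_def)
qed

text \<open>
The sets \<open>X i\<close> whose cube lies in the triple of a selected cube are grouped together.  The selected
cubes are disjoint, so the bounds on the groups add up to at most the integral of \<open>g\<close>.
\<close>

lemma finite_covering_estimate:
  fixes a :: "'i \<Rightarrow> real ^ 'n" and g :: "real ^ 'n \<Rightarrow> ennreal"
  assumes "finite I" and pos: "\<And>i. i \<in> I \<Longrightarrow> 0 < l i"
    and X: "\<And>i. i \<in> I \<Longrightarrow> X i \<in> sets lebesgue"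
    and [measurable]: "g \<in> borel_measurable lebesgue"
    and bound: "\<And>j. j \<in> I \<Longrightarrow>
      emeasure lebesgue (\<Union>i\<in>{i \<in> I. cube (a i) (l i) \<subseteq> cube (a j - vec (l j)) (3 * l j)}. X i)
        \<le> (\<integral>\<^sup>+ y \<in> cube (a j) (l j). g y \<partial>lebesgue)"
  shows "emeasure lebesgue (\<Union>i\<in>I. X i) \<le> (\<integral>\<^sup>+ y. g y \<partial>lebesgue)"
proof -
  let ?U = "\<lambda>j. \<Union>i\<in>{i \<in> I. cube (a i) (l i) \<subseteq> cube (a j - vec (l j)) (3 * l j)}. X i"
  obtain T where T: "T \<subseteq> I" "disjoint_family_on (\<lambda>i. cube (a i) (l i)) T"
    "\<forall>i\<in>I. \<exists>j\<in>T. cube (a i) (l i) \<subseteq> cube (a j - vec (l j)) (3 * l j)"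
    using finite_vitali_cubes[of I l a] assms(1) pos by blast
  have fT: "finite T" using T(1) assms(1) finite_subset by blast
  have Um: "?U j \<in> sets lebesgue" for j
    using assms(1) X by (intro sets.finite_UN) auto
  have "emeasure lebesgue (\<Union>i\<in>I. X i) \<le> emeasure lebesgue (\<Union>j\<in>T. ?U j)"
  proof (rule emeasure_mono)
    show "(\<Union>i\<in>I. X i) \<subseteq> (\<Union>j\<in>T. ?U j)"
      using T(3) by blast
    show "(\<Union>j\<in>T. ?U j) \<in> sets lebesgue"
      using fT Um by (rule sets.finite_UN)
  qed
  also have "\<dots> \<le> (\<Sum>j\<in>T. emeasure lebesgue (?U j))"
    using fT Um by (intro emeasure_subadditive_finite) auto
  also have "\<dots> \<le> (\<Sum>j\<in>T. \<integral>\<^sup>+ y \<in> cube (a j) (l j). g y \<partial>lebesgue)"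
    using T(1) bound by (intro sum_mono) auto
  also have "\<dots> = (\<Sum>j\<in>T. emeasure (density lebesgue g) (cube (a j) (l j)))"
    by (simp add: emeasure_density)
  also have "\<dots> = emeasure (density lebesgue g) (\<Union>j\<in>T. cube (a j) (l j))"
    using T(2) fT by (intro sum_emeasure) auto
  also have "\<dots> \<le> emeasure (density lebesgue g) (space lebesgue)"
    by (metis emeasure_space space_density)
  also have "\<dots> = (\<integral>\<^sup>+ y. g y \<partial>lebesgue)"
    by (subst emeasure_density) (auto intro!: nn_integral_cong)
  finally show ?thesis .
qed

text \<open>
A countable union is the increasing union of finite ones, for which the bound does not depend on
the number of cubes.  The sets \<open>X i\<close> need not be the whole cubes: with \<open>X i\<close> the part of
the cube on which some quantity is large, the grouping inside triples allows that quantity to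
depend on the cube.
\<close>

lemma covering_estimate:
  fixes a :: "'i \<Rightarrow> real ^ 'n" and g :: "real ^ 'n \<Rightarrow> ennreal"
  assumes "countable I" and pos: "\<And>i. i \<in> I \<Longrightarrow> 0 < l i"
    and X: "\<And>i. i \<in> I \<Longrightarrow> X i \<in> sets lebesgue"
    and [measurable]: "g \<in> borel_measurable lebesgue"
    and bound: "\<And>j. j \<in> I \<Longrightarrow>
      emeasure lebesgue (\<Union>i\<in>{i \<in> I. cube (a i) (l i) \<subseteq> cube (a j - vec (l j)) (3 * l j)}. X i)
        \<le> (\<integral>\<^sup>+ y \<in> cube (a j) (l j). g y \<partial>lebesgue)"
  shows "emeasure lebesgue (\<Union>i\<in>I. X i) \<le> (\<integral>\<^sup>+ y. g y \<partial>lebesgue)"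
proof (cases "I = {}")
  case False
  define e where "e n = from_nat_into I ` {..n}" for n :: nat
  have e: "e n \<subseteq> I" "finite (e n)" for n
    using False by (auto simp: e_def intro: from_nat_into)
  have I: "I = (\<Union>n. e n)"
  proof
    show "I \<subseteq> (\<Union>n. e n)"
    proof
      fix x assume "x \<in> I"
      then obtain n where "x = from_nat_into I n"
        using range_from_nat_into[OF False assms(1)] by blast
      then show "x \<in> (\<Union>n. e n)" by (auto simp: e_def)
    qed
  qed (use e in auto)
  have sets: "(\<Union>i\<in>e n. X i) \<in> sets lebesgue" for n
    using e X by (intro sets.finite_UN) blast+
  have "(\<Union>i\<in>I. X i) = (\<Union>n. \<Union>i\<in>e n. X i)" using I by auto
  moreover have "incseq (\<lambda>n. \<Union>i\<in>e n. X i)"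
    by (auto simp: incseq_def e_def) (meson order_trans atMost_iff imageI)
  ultimately have "emeasure lebesgue (\<Union>i\<in>I. X i) = (SUP n. emeasure lebesgue (\<Union>i\<in>e n. X i))"
    using SUP_emeasure_incseq[of "\<lambda>n. \<Union>i\<in>e n. X i" lebesgue] sets by (simp add: image_subset_iff)
  also have "\<dots> \<le> (\<integral>\<^sup>+ y. g y \<partial>lebesgue)"
  proof (rule SUP_least)
    fix n
    show "emeasure lebesgue (\<Union>i\<in>e n. X i) \<le> (\<integral>\<^sup>+ y. g y \<partial>lebesgue)"
    proof (rule finite_covering_estimate[where a = a and l = l])
      fix j assume j: "j \<in> e n"
      have "emeasure lebesgue (\<Union>i\<in>{i \<in> e n. cube (a i) (l i) \<subseteq> cube (a j - vec (l j)) (3 * l j)}. X i)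
        \<le> emeasure lebesgue (\<Union>i\<in>{i \<in> I. cube (a i) (l i) \<subseteq> cube (a j - vec (l j)) (3 * l j)}. X i)"
        using assms(1) X e(1)[of n] by (intro emeasure_mono sets.countable_UN') auto
      also have "\<dots> \<le> (\<integral>\<^sup>+ y \<in> cube (a j) (l j). g y \<partial>lebesgue)"
        using bound e(1) j by blast
      finally show "emeasure lebesgue (\<Union>i\<in>{i \<in> e n. cube (a i) (l i) \<subseteq> cube (a j - vec (l j)) (3 * l j)}. X i)
        \<le> (\<integral>\<^sup>+ y \<in> cube (a j) (l j). g y \<partial>lebesgue)" .
    qed (use e pos X in \<open>blast | simp\<close>)+
  qed
  finally show ?thesis .
qed simp

section \<open>Stopping cubes in an open set\<close>

abbreviation centred_cube :: "real ^ 'n \<Rightarrow> real \<Rightarrow> (real ^ 'n) set" where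
  "centred_cube x l \<equiv> cube (x - vec (l / 2)) l"

lemma lmeasurable_cube [simp, intro]: "cube a l \<in> lmeasurable"
  by (simp add: cube_def)

lemma lmeasurable_subset_cube: "S \<in> sets lebesgue \<Longrightarrow> S \<subseteq> cube a l \<Longrightarrow> S \<in> lmeasurable"
  by (meson fmeasurableI2 lmeasurable_cube)

lemma chebyshev_on_set:
  assumes "S \<in> sets M" "S \<subseteq> Q" "\<And>x. x \<in> S \<Longrightarrow> c \<le> h x"
  shows "c * emeasure M S \<le> (\<integral>\<^sup>+ y \<in> Q. h y \<partial>M)"
proof -
  have "c * emeasure M S = (\<integral>\<^sup>+ y. c * indicator S y \<partial>M)"
    using assms(1) by (simp add: nn_integral_cmult_indicator)
  also have "\<dots> \<le> (\<integral>\<^sup>+ y \<in> Q. h y \<partial>M)"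
    using assms(2,3) by (intro nn_integral_mono) (auto simp: indicator_def)
  finally show ?thesis .
qed

lemma centred_cube_in_open:
  fixes x :: "real ^ 'n"
  assumes "open U" "x \<in> U"
  obtains e where "0 < e" "\<And>l. l < e \<Longrightarrow> centred_cube x l \<subseteq> U"
proof -
  obtain r where r: "0 < r" "ball x r \<subseteq> U" using assms open_contains_ball by blast
  have "centred_cube x l \<subseteq> U" if l: "l < 2 * r / real CARD('n)" for l
  proof
    fix y assume y: "y \<in> centred_cube x l"
    have "norm (y - x) \<le> (\<Sum>i\<in>UNIV. \<bar>(y - x) $ i\<bar>)" by (rule norm_le_l1_cart)
    also have "\<dots> \<le> (\<Sum>i\<in>(UNIV :: 'n set). l / 2)"
    proof (rule sum_mono)
      fix i
      have "x $ i - l / 2 \<le> y $ i \<and> y $ i \<le> x $ i - l / 2 + l"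
        using y unfolding mem_cube by simp
      then show "\<bar>(y - x) $ i\<bar> \<le> l / 2" unfolding vector_minus_component by linarith
    qed
    also have "\<dots> < r" using l by (simp add: field_simps)
    finally have "y \<in> ball x r" by (simp add: dist_norm norm_minus_commute)
    then show "y \<in> U" using r by blast
  qed
  then show ?thesis using that[of "2 * r / real CARD('n)"] r by simp
qed

text \<open>
The side \<open>L\<close> is halved until the cube centred at \<open>x\<close> meets \<open>U\<close> in more than the proportion
\<open>d\<close>.  This does not happen at side \<open>L\<close>, as \<open>U\<close> is small, and it happens eventually, as \<open>U\<close> is
open; just before stopping, the proportion is still at most \<open>d\<close>.
\<close>

lemma stopping_cube:
  fixes x :: "real ^ 'n"
  assumes U: "open U" "U \<in> lmeasurable" "x \<in> U" and L: "0 < L"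
    and d: "d < 1" and small: "measure lebesgue U \<le> d * L ^ CARD('n)"
  shows "\<exists>l>0. 2 * l \<le> L \<and> d * l ^ CARD('n) < measure lebesgue (U \<inter> centred_cube x l) \<and>
     measure lebesgue (U \<inter> centred_cube x (2 * l)) \<le> d * (2 * l) ^ CARD('n)"
proof -
  define P where "P k \<longleftrightarrow> d * (L / 2 ^ k) ^ CARD('n) < measure lebesgue (U \<inter> centred_cube x (L / 2 ^ k))" for k :: nat
  obtain e where e: "0 < e" "\<And>l. l < e \<Longrightarrow> centred_cube x l \<subseteq> U" using centred_cube_in_open U by metis
  have "\<exists>k. P k"
  proof -
    obtain k :: nat where k: "L / e < 2 ^ k" using real_arch_pow[of 2 "L / e"] by auto
    then have "L / 2 ^ k < e" using e(1) by (simp add: field_simps)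
    then have "U \<inter> centred_cube x (L / 2 ^ k) = centred_cube x (L / 2 ^ k)" using e(2) by blast
    moreover have "0 < (L / 2 ^ k) ^ CARD('n)" using L by simp
    ultimately have "P k" using L d by (simp only: P_def measure_cube) (simp add: measure_cube)
    then show ?thesis by blast
  qed
  define k where "k = (LEAST k. P k)"
  have Pk: "P k" unfolding k_def using \<open>\<exists>k. P k\<close> by (metis LeastI)
  have "\<not> P 0"
  proof -
    have "measure lebesgue (U \<inter> centred_cube x L) \<le> measure lebesgue U"
      using U by (intro measure_mono_fmeasurable) auto
    then show ?thesis using small by (simp add: P_def)
  qed
  then have "k \<noteq> 0" using Pk by metis
  then obtain j where j: "k = Suc j" using not0_implies_Suc by blast
  then have "\<not> P j" unfolding k_def using not_less_Least[of j P] by simp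
  moreover have "2 * (L / 2 ^ k) = L / 2 ^ j" by (simp add: j)
  moreover have "L / 2 ^ j \<le> L" using L by (simp add: field_simps)
  ultimately show ?thesis
    using Pk L unfolding P_def by (intro exI[of _ "L / 2 ^ k"]) (simp add: not_less)
qed

text \<open>
The cube of side \<open>2 * l\<close> centred at \<open>x\<close> may stick out of the cube that contains \<open>x\<close>; in each
coordinate one of the two halves stays inside.
\<close>

lemma half_cube_in_intersection:
  fixes x :: "real ^ 'n"
  assumes x: "x \<in> cube a L" and l: "0 < l" "2 * l \<le> L"
  obtains a' where "cube a' l \<subseteq> cube a L \<inter> centred_cube x (2 * l)"
proof
  let ?a = "\<chi> i. if a $ i \<le> x $ i - l then x $ i - l else x $ i"
  show "cube ?a l \<subseteq> cube a L \<inter> centred_cube x (2 * l)"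
  proof
    fix y assume y: "y \<in> cube ?a l"
    have "a $ i \<le> y $ i \<and> y $ i \<le> a $ i + L \<and> x $ i - l \<le> y $ i \<and> y $ i \<le> x $ i + l" for i
      using y x l unfolding mem_cube by (auto dest!: spec[of _ i] split: if_splits)
    then show "y \<in> cube a L \<inter> centred_cube x (2 * l)" by (auto simp: mem_cube add.commute)
  qed
qed

section \<open>The John-Nirenberg inequality\<close>

lemma mean_value_diff_le:
  fixes a :: "real ^ 'n"
  assumes l: "0 < l" and b: "set_integrable lebesgue (cube a l) b"
  shows "ennreal (\<bar>mean_value b (cube a l) - c\<bar> * l ^ CARD('n)) \<le> (\<integral>\<^sup>+ y \<in> cube a l. ennreal \<bar>b y - c\<bar> \<partial>lebesgue)"
proof -
  let ?Q = "cube a l"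
  have c: "set_integrable lebesgue ?Q (\<lambda>y. c)"
    unfolding set_integrable_def using emeasure_cube[of l a] l by simp
  have 1: "set_integrable lebesgue ?Q (\<lambda>y. b y - c)"
    using b c by (rule set_integral_diff)
  have "(LINT y:?Q|lebesgue. b y - c) = (LINT y:?Q|lebesgue. b y) - (LINT y:?Q|lebesgue. c)"
    using b c by (rule set_integral_diff)
  also have "(LINT y:?Q|lebesgue. c) = c * l ^ CARD('n)"
    unfolding set_lebesgue_integral_def using l measure_cube[of l a] by simp
  also have "(LINT y:?Q|lebesgue. b y) = mean_value b (cube a l) * l ^ CARD('n)"
    using l by (simp add: mean_value_def measure_cube)
  finally have "\<bar>mean_value b (cube a l) - c\<bar> * l ^ CARD('n) = \<bar>LINT y:?Q|lebesgue. b y - c\<bar>"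
    using l by (simp add: abs_mult flip: left_diff_distrib)
  also have "ennreal \<dots> \<le> (\<integral>\<^sup>+ y. ennreal (norm (indicator ?Q y *\<^sub>R (b y - c))) \<partial>lebesgue)"
    using integral_norm_bound_ennreal[of lebesgue "\<lambda>y. indicator ?Q y *\<^sub>R (b y - c)"] 1
    unfolding set_lebesgue_integral_def set_integrable_def by simp
  also have "\<dots> = (\<integral>\<^sup>+ y \<in> ?Q. ennreal \<bar>b y - c\<bar> \<partial>lebesgue)"
    by (intro nn_integral_cong) (auto simp: indicator_def)
  finally show ?thesis .
qed

text \<open>
Bounded mean oscillation with an explicit positive bound; integrals are compared with the volume,
which avoids quotients of extended reals.
\<close>

locale bounded_oscillation =
  fixes b :: "real ^ 'n \<Rightarrow> real" and B :: real
  assumes b_measurable [measurable]: "b \<in> borel_measurable lebesgue"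
    and B_pos: "0 < B"
    and b_integrable: "\<And>a l. 0 < l \<Longrightarrow> set_integrable lebesgue (cube a l) b"
    and b_oscillation: "\<And>a l. 0 < l \<Longrightarrow>
      (\<integral>\<^sup>+ y \<in> cube a l. ennreal \<bar>b y - mean_value b (cube a l)\<bar> \<partial>lebesgue) \<le> ennreal (B * l ^ CARD('n))"
begin

abbreviation mean :: "real ^ 'n \<Rightarrow> real \<Rightarrow> real" where
  "mean a l \<equiv> mean_value b (cube a l)"

lemma mean_diff_le:
  assumes "0 < l"
  shows "ennreal (\<bar>mean a l - c\<bar> * l ^ CARD('n)) \<le> (\<integral>\<^sup>+ y \<in> cube a l. ennreal \<bar>b y - c\<bar> \<partial>lebesgue)"
  by (rule mean_value_diff_le) (use assms b_integrable in auto)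

text \<open>
The step by which the level is raised to divide the measure of the level set by 4.  In the triple of
a stopping cube, \<open>2 * 3 ^ n * B\<close> of it make up for the difference of two means, and the remaining
\<open>16 * 6 ^ n * B\<close> are the level at which Chebyshev's inequality is applied.
\<close>

definition K :: real where "K = 18 * 6 ^ CARD('n) * B"

definition level :: "real ^ 'n \<Rightarrow> real \<Rightarrow> real \<Rightarrow> (real ^ 'n) set" where
  "level a L t = {x \<in> cube a L. t < \<bar>b x - mean a L\<bar>}"

lemma level_measurable [measurable, simp]: "level a L t \<in> sets lebesgue"
proof -
  have "level a L t = cube a L \<inter> {x \<in> space lebesgue. t < \<bar>b x - mean a L\<bar>}"
    by (auto simp: level_def)
  then show ?thesis by simp
qed

lemma level_lmeasurable [simp, intro]: "level a L t \<in> lmeasurable"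
  by (rule lmeasurable_subset_cube[of _ a L]) (auto simp: level_def)

text \<open>
Here \<open>U\<close> occupies at most the proportion \<open>1 / 2 ^ (n + 1)\<close> of the cube of side \<open>2 * l\<close>, whereas
the part of that cube inside \<open>cube a L\<close> contains a cube of side \<open>l\<close>, of proportion \<open>1 / 2 ^ n\<close>.  So on
a set of measure at least \<open>l ^ n / 2\<close> the function \<open>b\<close> is within \<open>t\<close> of its mean over
\<open>cube a L\<close>, and therefore the mean over the triple is within \<open>t\<close> of it, up to a multiple of
\<open>B\<close>.  Above the level \<open>t + K\<close>, \<open>b\<close> is then far from its mean over the triple, which Chebyshev's
inequality makes rare.
\<close>

lemma level_shift_in_triple:
  assumes L: "0 < L" and l: "0 < l" "2 * l \<le> L" and x: "x \<in> cube a L"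
    and U: "U \<in> lmeasurable" "level a L t \<subseteq> U"
    and stop: "measure lebesgue (U \<inter> centred_cube x (2 * l)) \<le> (2 * l) ^ CARD('n) / 2 ^ (CARD('n) + 1)"
  shows "measure lebesgue (level a L (t + K) \<inter> cube (x - vec (3 * l / 2)) (3 * l))
      \<le> l ^ CARD('n) / (16 * 2 ^ CARD('n))"
proof -
  define n where "n = CARD('n)"
  let ?P = "cube (x - vec (3 * l / 2)) (3 * l)"
  let ?m = "mean a L" and ?p = "mean (x - vec (3 * l / 2)) (3 * l)"
  obtain a' where a': "cube a' l \<subseteq> cube a L \<inter> centred_cube x (2 * l)"
    using half_cube_in_intersection[OF x l] .
  have sub: "centred_cube x (2 * l) \<subseteq> ?P"
  proof
    fix y assume y: "y \<in> centred_cube x (2 * l)"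
    have "x $ i - 3 * l / 2 \<le> y $ i \<and> y $ i \<le> x $ i - 3 * l / 2 + 3 * l" for i
      using y l unfolding mem_cube by (auto dest!: spec[of _ i])
    then show "y \<in> ?P" by (simp add: mem_cube)
  qed
  let ?G = "cube a' l - U"
  have "l ^ n - measure lebesgue (U \<inter> centred_cube x (2 * l)) \<le> measure lebesgue (cube a' l) - measure lebesgue (cube a' l \<inter> U)"
    using a' U(1) l by (intro diff_mono measure_mono_fmeasurable) (auto simp: measure_cube n_def)
  also have "\<dots> = measure lebesgue ?G"
    using U(1) measurable_measure_Diff[of "cube a' l" lebesgue "cube a' l \<inter> U"] by (simp add: Diff_Int_distrib2 fmeasurableD sets.Int Diff_Int)
  finally have G: "l ^ n / 2 \<le> measure lebesgue ?G"
    using stop l by (simp add: n_def power_mult_distrib)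
  have Gm: "?G \<in> lmeasurable" using U(1) by (intro fmeasurable.Diff) auto
  have osc: "(\<integral>\<^sup>+ y \<in> ?P. ennreal \<bar>b y - ?p\<bar> \<partial>lebesgue) \<le> ennreal (B * (3 * l) ^ n)"
    using b_oscillation[of "3 * l"] l by (simp add: n_def)
  have "ennreal ((\<bar>?p - ?m\<bar> - t) * (l ^ n / 2)) \<le> ennreal (\<bar>?p - ?m\<bar> - t) * emeasure lebesgue ?G"
    unfolding emeasure_eq_measure2[OF Gm]
    using G l by (subst ennreal_mult'') (auto intro!: mult_left_mono ennreal_leI)
  also have "\<dots> \<le> (\<integral>\<^sup>+ y \<in> ?P. ennreal \<bar>b y - ?p\<bar> \<partial>lebesgue)"
  proof (rule chebyshev_on_set)
    fix y assume "y \<in> ?G"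
    then have "\<bar>b y - ?m\<bar> \<le> t" using a' U(2) by (fastforce simp: level_def)
    then show "ennreal (\<bar>?p - ?m\<bar> - t) \<le> ennreal \<bar>b y - ?p\<bar>" by (intro ennreal_leI) linarith
  qed (use Gm a' sub in auto)
  also note osc
  finally have "(\<bar>?p - ?m\<bar> - t) * (l ^ n / 2) \<le> B * (3 * l) ^ n"
    using B_pos l by simp
  also have "\<dots> = (2 * 3 ^ n * B) * (l ^ n / 2)" by (simp add: power_mult_distrib)
  finally have mm: "\<bar>?p - ?m\<bar> - t \<le> 2 * 3 ^ n * B" using l by simp
  let ?S = "level a L (t + K) \<inter> ?P"
  have "ennreal (16 * 6 ^ n * B) * emeasure lebesgue ?S \<le> (\<integral>\<^sup>+ y \<in> ?P. ennreal \<bar>b y - ?p\<bar> \<partial>lebesgue)"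
  proof (rule chebyshev_on_set)
    fix y assume "y \<in> ?S"
    then have "t + K < \<bar>b y - ?m\<bar>" by (simp add: level_def)
    moreover have "2 * 3 ^ n * B \<le> 2 * 6 ^ n * B"
      using B_pos by (simp add: power_mono)
    ultimately show "ennreal (16 * 6 ^ n * B) \<le> ennreal \<bar>b y - ?p\<bar>"
      using mm unfolding K_def n_def[symmetric] by (intro ennreal_leI) linarith
  qed auto
  also note osc
  finally have "ennreal (16 * 6 ^ n * B * measure lebesgue ?S) \<le> ennreal (B * (3 * l) ^ n)"
    using B_pos by (simp add: emeasure_eq_measure2 fmeasurable.Int ennreal_mult'')
  then have "16 * 6 ^ n * B * measure lebesgue ?S \<le> B * (3 * l) ^ n"
    using B_pos l by simp
  moreover have "(6::real) ^ n = 3 ^ n * 2 ^ n" by (simp flip: power_mult_distrib)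
  ultimately have "3 ^ n * B * (16 * 2 ^ n * measure lebesgue ?S) \<le> 3 ^ n * B * l ^ n"
    by (simp add: power_mult_distrib mult_ac)
  then have "16 * 2 ^ n * measure lebesgue ?S \<le> l ^ n" using B_pos by simp
  then show ?thesis unfolding n_def[symmetric] by (simp add: field_simps)
qed

text \<open>
The key step of the John-Nirenberg inequality.  An open set \<open>U\<close> of at most twice the measure of the
level set contains it, and stopping cubes for the density of \<open>U\<close> cover the level set.  In the
triple of each of them the higher level set is small compared with the part of \<open>U\<close> in the cube,
and the covering estimate adds this up.
\<close>

lemma level_shift:
  assumes L: "0 < L" and small: "measure lebesgue (level a L t) \<le> L ^ CARD('n) / 2 ^ (CARD('n) + 2)"
  shows "measure lebesgue (level a L (t + K)) \<le> measure lebesgue (level a L t) / 4"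
proof (cases "measure lebesgue (level a L t) = 0")
  case True
  have "measure lebesgue (level a L (t + K)) \<le> measure lebesgue (level a L t)"
  proof (rule measure_mono_fmeasurable)
    have "0 < K" using B_pos by (simp add: K_def)
    then show "level a L (t + K) \<subseteq> level a L t" by (auto simp: level_def)
  qed auto
  then show ?thesis using True by simp
next
  case False
  define n where "n = CARD('n)"
  define \<mu> where "\<mu> = measure lebesgue (level a L t)"
  have \<mu>: "0 < \<mu>" using False by (simp add: \<mu>_def zero_less_measure_iff)
  \<comment> \<open>Half the proportion of the centred cube that is guaranteed to lie in \<open>cube a L\<close>.\<close>
  define d :: real where "d = 1 / 2 ^ (n + 1)"
  have d: "0 < d" "d < 1" unfolding d_def using one_less_power[of "2::real" "n + 1"] by (simp_all add: field_simps)
  obtain U where U: "open U" "level a L t \<subseteq> U" "U - level a L t \<in> lmeasurable"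
    "emeasure lebesgue (U - level a L t) < ennreal \<mu>"
    using sets_lebesgue_outer_open[OF level_measurable[of a L t] \<mu>] by metis
  have Um: "U \<in> lmeasurable"
    using fmeasurable.Un[OF U(3) level_lmeasurable[of a L t]] U(2) by (simp add: Un_absorb2)
  have "measure lebesgue U = measure lebesgue (U - level a L t) + \<mu>"
    using measurable_measure_Diff[OF Um, of "level a L t"] U(2) by (simp add: \<mu>_def)
  moreover have "measure lebesgue (U - level a L t) < \<mu>"
    using U(4) unfolding emeasure_eq_measure2[OF U(3)] by (simp add: ennreal_less_iff)
  ultimately have U2: "measure lebesgue U \<le> 2 * \<mu>" by simp
  also have "\<dots> \<le> d * L ^ n" using small by (simp add: d_def n_def \<mu>_def)
  finally have Ud: "measure lebesgue U \<le> d * L ^ CARD('n)" by (simp add: n_def)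
  define Good where "Good x l \<longleftrightarrow> 0 < l \<and> 2 * l \<le> L \<and> d * l ^ n < measure lebesgue (U \<inter> centred_cube x l) \<and>
     measure lebesgue (U \<inter> centred_cube x (2 * l)) \<le> d * (2 * l) ^ n" for x l
  have "\<exists>l. Good x l" if "x \<in> level a L t" for x
    using stopping_cube[OF U(1) Um _ L d(2) Ud] that U(2) unfolding Good_def n_def by blast
  then obtain l where "\<And>x. x \<in> level a L t \<Longrightarrow> Good x (l x)" by metis
  then have l: "0 < l x" "2 * l x \<le> L" "d * l x ^ n < measure lebesgue (U \<inter> centred_cube x (l x))"
     "measure lebesgue (U \<inter> centred_cube x (2 * l x)) \<le> d * (2 * l x) ^ n" if "x \<in> level a L t" for x
    using that by (auto simp: Good_def)
  define O' where "O' x = box (x - vec (l x / 2)) (x + vec (l x / 2))" for x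
  \<comment> \<open>Lindelof, applied to the open cubes, makes the family of stopping cubes countable.\<close>
  obtain F where F: "F \<subseteq> O' ` level a L t" "countable F" "\<Union>F = \<Union>(O' ` level a L t)"
    using Lindelof[of "O' ` level a L t"] by (auto simp: O'_def)
  obtain D where D: "D \<subseteq> level a L t" "countable D" "F = O' ` D"
    using F(1,2) countable_subset_image[of F O' "level a L t"] by auto
  have Osub: "O' x \<subseteq> centred_cube x (l x)" for x
  proof
    fix y assume "y \<in> O' x"
    then have "x $ i - l x / 2 \<le> y $ i \<and> y $ i \<le> x $ i - l x / 2 + l x" for i
      unfolding O'_def mem_box_cart by (auto dest!: spec[of _ i])
    then show "y \<in> centred_cube x (l x)" by (simp add: mem_cube)
  qed
  have xO: "x \<in> O' x" if "x \<in> level a L t" for x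
    using l(1)[OF that] by (simp add: O'_def mem_box_cart)
  have K: "0 < K" using B_pos by (simp add: K_def)
  let ?X = "\<lambda>x. centred_cube x (l x) \<inter> level a L (t + K)"
  have sub: "level a L (t + K) \<subseteq> (\<Union>x\<in>D. ?X x)"
  proof
    fix x assume x: "x \<in> level a L (t + K)"
    then have "x \<in> level a L t" using K by (auto simp: level_def)
    then have "x \<in> \<Union>F" using F(3) xO by blast
    then show "x \<in> (\<Union>x\<in>D. ?X x)" using D(3) Osub x by blast
  qed
  have "emeasure lebesgue (level a L (t + K)) \<le> emeasure lebesgue (\<Union>x\<in>D. ?X x)"
    using sub D(2) by (intro emeasure_mono sets.countable_UN') auto
  also have "\<dots> \<le> (\<integral>\<^sup>+ y. ennreal (1 / 8) * indicator U y \<partial>lebesgue)"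
  proof (rule covering_estimate[where a = "\<lambda>x. x - vec (l x / 2)" and l = l])
    fix x assume "x \<in> D"
    then have x: "x \<in> level a L t" using D by blast
    then have xQ: "x \<in> cube a L" by (simp add: level_def)
    let ?T = "cube (x - vec (3 * l x / 2)) (3 * l x)"
    have eq: "x - vec (l x / 2) - vec (l x) = x - vec (3 * l x / 2)"
      by (simp add: vec_eq_iff)
    have "measure lebesgue (level a L (t + K) \<inter> ?T) \<le> l x ^ n / (16 * 2 ^ n)"
      unfolding n_def
      by (rule level_shift_in_triple[OF L l(1,2)[OF x] xQ Um U(2)]) (use l(4)[OF x] in \<open>simp add: d_def n_def\<close>)
    also have "\<dots> \<le> measure lebesgue (U \<inter> centred_cube x (l x)) / 8"
      using l(3)[OF x] by (simp add: d_def field_simps)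
    finally have le: "emeasure lebesgue (level a L (t + K) \<inter> ?T)
        \<le> ennreal (1 / 8) * emeasure lebesgue (U \<inter> centred_cube x (l x))"
      using Um by (simp add: emeasure_eq_measure2 fmeasurable.Int ennreal_mult''[symmetric] ennreal_leI)
    have "emeasure lebesgue (\<Union>i\<in>{i \<in> D. centred_cube i (l i) \<subseteq> cube (x - vec (l x / 2) - vec (l x)) (3 * l x)}. ?X i)
      \<le> emeasure lebesgue (level a L (t + K) \<inter> ?T)"
      unfolding eq by (intro emeasure_mono) auto
    also note le
    also have "ennreal (1 / 8) * emeasure lebesgue (U \<inter> centred_cube x (l x))
       = (\<integral>\<^sup>+ y. ennreal (1 / 8) * indicator (U \<inter> centred_cube x (l x)) y \<partial>lebesgue)"
      using Um by (subst nn_integral_cmult_indicator) auto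
    also have "\<dots> = (\<integral>\<^sup>+ y \<in> centred_cube x (l x). ennreal (1 / 8) * indicator U y \<partial>lebesgue)"
      by (intro nn_integral_cong) (auto simp: indicator_def)
    finally show "emeasure lebesgue (\<Union>i\<in>{i \<in> D. centred_cube i (l i) \<subseteq> cube (x - vec (l x / 2) - vec (l x)) (3 * l x)}. ?X i)
      \<le> (\<integral>\<^sup>+ y \<in> centred_cube x (l x). ennreal (1 / 8) * indicator U y \<partial>lebesgue)" .
  qed (use D Um l in auto)
  also have "\<dots> = ennreal (measure lebesgue U / 8)"
    using Um by (subst nn_integral_cmult_indicator) (auto simp: emeasure_eq_measure2 ennreal_mult''[symmetric])
  finally have "measure lebesgue (level a L (t + K)) \<le> measure lebesgue U / 8"
    by (simp add: emeasure_eq_measure2)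
  then show ?thesis using U2 by (simp add: \<mu>_def)
qed

lemma K_pos: "0 < K"
  using B_pos by (simp add: K_def)

lemma level_decay:
  assumes L: "0 < L"
  shows "measure lebesgue (level a L (real (j + 1) * K)) \<le> L ^ CARD('n) / 2 ^ (CARD('n) + 2) / 4 ^ j"
proof (induction j)
  case 0
  define n where "n = CARD('n)"
  have "ennreal K * emeasure lebesgue (level a L K) \<le> (\<integral>\<^sup>+ y \<in> cube a L. ennreal \<bar>b y - mean a L\<bar> \<partial>lebesgue)"
    by (rule chebyshev_on_set) (auto simp: level_def intro!: ennreal_leI)
  also note b_oscillation[OF L]
  finally have *: "K * measure lebesgue (level a L K) \<le> B * L ^ n"
    using B_pos L K_pos by (simp add: emeasure_eq_measure2 ennreal_mult''[symmetric] n_def)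
  have "(2::real) ^ n \<le> 6 ^ n" by (rule power_mono) auto
  then have "4 * 2 ^ n \<le> 18 * (6::real) ^ n"
    using zero_le_power[of "6::real" n] by linarith
  then have "4 * 2 ^ n * B \<le> K"
    using B_pos unfolding K_def n_def[symmetric] by (intro mult_right_mono) auto
  then have "4 * 2 ^ n * B * measure lebesgue (level a L K) \<le> B * L ^ n"
    using * by (meson measure_nonneg mult_right_mono order_trans)
  then show ?case using B_pos unfolding n_def[symmetric] by (simp add: field_simps)
next
  case (Suc j)
  have "L ^ CARD('n) / 2 ^ (CARD('n) + 2) / 4 ^ j \<le> L ^ CARD('n) / 2 ^ (CARD('n) + 2)"
    using L by (intro divide_left_mono[of 1, simplified]) auto
  then have "measure lebesgue (level a L (real (j + 1) * K + K)) \<le> measure lebesgue (level a L (real (j + 1) * K)) / 4"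
    using Suc.IH L by (intro level_shift) linarith+
  also have "real (j + 1) * K + K = real (Suc j + 1) * K" by (simp add: algebra_simps)
  finally show ?case using Suc.IH by simp
qed

text \<open>
On the layer between the levels \<open>(j + 1) * K\<close> and \<open>(j + 2) * K\<close> the integrand is at most
\<open>2 ^ (j + 2)\<close>, while the measure of the layer decays like \<open>4 ^ (- j)\<close>.
\<close>

lemma John_Nirenberg:
  assumes L: "0 < L"
  shows "(\<integral>\<^sup>+ y \<in> cube a L. ennreal (exp (\<bar>b y - mean a L\<bar> / (2 * K))) \<partial>lebesgue) \<le> ennreal (10 * L ^ CARD('n))"
proof -
  define n where "n = CARD('n)"
  let ?w = "\<lambda>y. \<bar>b y - mean a L\<bar> / (2 * K)"
  let ?E = "\<lambda>j. level a L (real (j + 1) * K)"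
  have e2: "exp (1 / 2 :: real) \<le> 2"
    by (rule exp_half_le2)
  have exp_le: "exp (real k / 2) \<le> 2 ^ k" for k :: nat
  proof -
    have "exp (real k / 2) = exp (1 / 2) ^ k" by (simp flip: exp_of_nat_mult)
    also have "\<dots> \<le> 2 ^ k" using e2 by (intro power_mono) auto
    finally show ?thesis .
  qed
  have pw: "ennreal (exp (?w y)) * indicator (cube a L) y \<le>
     ennreal 2 * indicator (cube a L) y + (\<Sum>j. ennreal (2 ^ (j + 2)) * indicator (?E j) y)" for y
  proof (cases "y \<in> cube a L")
    case True
    show ?thesis
    proof (cases "\<bar>b y - mean a L\<bar> \<le> K")
      case le: True
      then have "?w y \<le> 1 / 2" using K_pos by (simp add: field_simps)
      then have "exp (?w y) \<le> 2" using e2 by (meson exp_le_cancel_iff order_trans)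
      then have "ennreal (exp (?w y)) * indicator (cube a L) y \<le> ennreal 2 * indicator (cube a L) y"
        by (intro mult_right_mono ennreal_leI) auto
      then show ?thesis by (simp add: add_increasing2)
    next
      case False
      define r where "r = \<bar>b y - mean a L\<bar> / K"
      have r: "1 < r" using False K_pos by (simp add: r_def field_simps)
      \<comment> \<open>The layer that contains \<open>y\<close>: \<open>(k + 1) * K < \<bar>b y - mean a L\<bar> \<le> (k + 2) * K\<close>.\<close>
      define k where "k = nat (\<lceil>r\<rceil> - 2)"
      have k: "real k + 1 < r" "r \<le> real k + 2"
        using r unfolding k_def by linarith+
      have "exp (?w y) \<le> exp (real (k + 2) / 2)"
        using k(2) K_pos by (simp add: r_def field_simps)
      also have "\<dots> \<le> 2 ^ (k + 2)" by (rule exp_le)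
      finally have "ennreal (exp (?w y)) * indicator (cube a L) y \<le> ennreal (2 ^ (k + 2)) * indicator (?E k) y"
        using True k(1) K_pos by (simp add: level_def r_def field_simps ennreal_leI del: ennreal_power)
      also have "\<dots> \<le> (\<Sum>j. ennreal (2 ^ (j + 2)) * indicator (?E j) y)"
        using sum_le_suminf[of "\<lambda>j. ennreal (2 ^ (j + 2)) * indicator (?E j) y" "{k}", OF summableI]
        by (simp only: sum.insert[OF finite.emptyI] sum.empty empty_iff add_0_right finite.intros not_False_eq_True zero_le simp_thms)
      finally show ?thesis by (simp add: add_increasing)
    qed
  qed simp
  have "(\<integral>\<^sup>+ y \<in> cube a L. ennreal (exp (?w y)) \<partial>lebesgue)
     \<le> (\<integral>\<^sup>+ y. ennreal 2 * indicator (cube a L) y + (\<Sum>j. ennreal (2 ^ (j + 2)) * indicator (?E j) y) \<partial>lebesgue)"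
    by (rule nn_integral_mono) (rule pw)
  also have "\<dots> = (\<integral>\<^sup>+ y. ennreal 2 * indicator (cube a L) y \<partial>lebesgue)
      + (\<Sum>j. (\<integral>\<^sup>+ y. ennreal (2 ^ (j + 2)) * indicator (?E j) y \<partial>lebesgue))"
    by (subst nn_integral_add) (auto simp: nn_integral_suminf simp del: ennreal_power)
  also have "(\<integral>\<^sup>+ y. ennreal 2 * indicator (cube a L) y \<partial>lebesgue) = ennreal (2 * L ^ n)"
    using L by (subst nn_integral_cmult_indicator)
      (auto simp: emeasure_cube n_def ennreal_mult simp del: emeasure_completion)
  also have "(\<Sum>j. (\<integral>\<^sup>+ y. ennreal (2 ^ (j + 2)) * indicator (?E j) y \<partial>lebesgue))
      \<le> (\<Sum>j. ennreal (4 * L ^ n * (1 / 2) ^ j))"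
  proof (intro suminf_le allI)
    fix j
    have "(\<integral>\<^sup>+ y. ennreal (2 ^ (j + 2)) * indicator (?E j) y \<partial>lebesgue) = ennreal (2 ^ (j + 2) * measure lebesgue (?E j))"
      by (subst nn_integral_cmult_indicator) (auto simp: emeasure_eq_measure2 ennreal_mult''[symmetric] simp del: ennreal_power)
    also have "\<dots> \<le> ennreal (4 * L ^ n * (1 / 2) ^ j)"
    proof (rule ennreal_leI)
      have "measure lebesgue (?E j) \<le> L ^ n / 2 ^ (n + 2) / 4 ^ j" unfolding n_def by (rule level_decay[OF L])
      also have "\<dots> \<le> L ^ n / 1 / 4 ^ j"
        using L one_le_power[of "2::real" "n + 2"] by (intro divide_right_mono divide_left_mono) auto
      finally have "2 ^ (j + 2) * measure lebesgue (?E j) \<le> 2 ^ (j + 2) * (L ^ n / 1 / 4 ^ j)"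
        by (rule mult_left_mono) simp
      also have "\<dots> = 4 * L ^ n * (2 ^ j / 4 ^ j)" by simp
      also have "(2::real) ^ j / 4 ^ j = (1 / 2) ^ j" by (simp flip: power_divide)
      finally show "2 ^ (j + 2) * measure lebesgue (?E j) \<le> 4 * L ^ n * (1 / 2) ^ j" .
    qed
    finally show "(\<integral>\<^sup>+ y. ennreal (2 ^ (j + 2)) * indicator (?E j) y \<partial>lebesgue) \<le> ennreal (4 * L ^ n * (1 / 2) ^ j)" .
  qed auto
  also have "(\<Sum>j. ennreal (4 * L ^ n * (1 / 2) ^ j)) = ennreal (8 * L ^ n)"
  proof -
    have "(\<lambda>j. 4 * L ^ n * (1 / 2) ^ j) sums (4 * L ^ n * 2)"
      using geometric_sums[of "1 / 2 :: real"] by (intro sums_mult) simp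
    then show ?thesis using L by (subst suminf_ennreal_eq) auto
  qed
  also have "ennreal (2 * L ^ n) + ennreal (8 * L ^ n) = ennreal (10 * L ^ n)"
    using L by (simp flip: ennreal_plus)
  finally show ?thesis by (simp add: n_def add_left_mono)
qed

end

section \<open>Weak-type estimates for means over cubes\<close>

text \<open>
The weak type (1,1) bound of the Hardy-Littlewood maximal function, for a given family of cubes.
\<close>

lemma weak_type_cubes:
  fixes a :: "'i \<Rightarrow> real ^ 'n" and h :: "real ^ 'n \<Rightarrow> ennreal"
  assumes I: "countable I" and pos: "\<And>i. i \<in> I \<Longrightarrow> 0 < l i"
    and sub: "\<And>i. i \<in> I \<Longrightarrow> cube (a i) (l i) \<subseteq> P"
    and [measurable]: "h \<in> borel_measurable lebesgue" "P \<in> sets lebesgue" and s: "0 < s"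
    and large: "\<And>i. i \<in> I \<Longrightarrow> ennreal (s * l i ^ CARD('n)) \<le> (\<integral>\<^sup>+ y \<in> cube (a i) (l i). h y \<partial>lebesgue)"
  shows "emeasure lebesgue (\<Union>i\<in>I. cube (a i) (l i)) \<le> ennreal (3 ^ CARD('n) / s) * (\<integral>\<^sup>+ y \<in> P. h y \<partial>lebesgue)"
proof -
  define n where "n = CARD('n)"
  have "emeasure lebesgue (\<Union>i\<in>I. cube (a i) (l i)) \<le> (\<integral>\<^sup>+ y. ennreal (3 ^ n / s) * (h y * indicator P y) \<partial>lebesgue)"
  proof (rule covering_estimate[where a = a and l = l])
    fix j assume j: "j \<in> I"
    have "emeasure lebesgue (\<Union>i\<in>{i \<in> I. cube (a i) (l i) \<subseteq> cube (a j - vec (l j)) (3 * l j)}. cube (a i) (l i))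
       \<le> emeasure lebesgue (cube (a j - vec (l j)) (3 * l j))"
      by (rule emeasure_mono) auto
    also have "\<dots> = ennreal (3 ^ n / s) * ennreal (s * l j ^ n)"
      using pos[OF j] s emeasure_cube[of "3 * l j" "a j - vec (l j)"]
      by (simp add: n_def power_mult_distrib ennreal_mult''[symmetric] del: emeasure_completion)
    also have "\<dots> \<le> ennreal (3 ^ n / s) * (\<integral>\<^sup>+ y \<in> cube (a j) (l j). h y \<partial>lebesgue)"
      unfolding n_def by (intro mult_left_mono large j) auto
    also have "\<dots> = (\<integral>\<^sup>+ y. ennreal (3 ^ n / s) * (h y * indicator (cube (a j) (l j)) y) \<partial>lebesgue)"
      by (rule nn_integral_cmult[symmetric]) auto
    also have "\<dots> = (\<integral>\<^sup>+ y \<in> cube (a j) (l j). ennreal (3 ^ n / s) * (h y * indicator P y) \<partial>lebesgue)"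
      using sub[OF j] by (intro nn_integral_cong) (auto simp: indicator_def)
    finally show "emeasure lebesgue (\<Union>i\<in>{i \<in> I. cube (a i) (l i) \<subseteq> cube (a j - vec (l j)) (3 * l j)}. cube (a i) (l i))
       \<le> (\<integral>\<^sup>+ y \<in> cube (a j) (l j). ennreal (3 ^ n / s) * (h y * indicator P y) \<partial>lebesgue)" .
  qed (use I pos in auto)
  also have "\<dots> = ennreal (3 ^ n / s) * (\<integral>\<^sup>+ y \<in> P. h y \<partial>lebesgue)"
    by (rule nn_integral_cmult) auto
  finally show ?thesis by (simp add: n_def)
qed

section \<open>The Young function of L log L\<close>

abbreviation \<Phi> :: "real \<Rightarrow> real" where "\<Phi> u \<equiv> u * (1 + log_plus u)"

lemma log_plus_nonneg [simp]: "0 \<le> log_plus u"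
  by (simp add: log_plus_def)

lemma log_plus_mono: "0 < u \<Longrightarrow> u \<le> v \<Longrightarrow> log_plus u \<le> log_plus v"
  by (auto simp: log_plus_def max_def)

lemma log_plus_measurable [measurable]: "log_plus \<in> borel_measurable borel"
  unfolding log_plus_def by measurable

lemma le_\<Phi>: "0 \<le> u \<Longrightarrow> u \<le> \<Phi> u"
  by (simp add: distrib_left)

text \<open>
The logarithmic factor is increasing; this is what gives the factor \<open>1 / t\<close> at the levels
\<open>t > 1\<close>.
\<close>

lemma \<Phi>_scale:
  assumes "0 \<le> u" "0 \<le> c" "c \<le> 1" shows "\<Phi> (c * u) \<le> c * \<Phi> u"
proof (cases "c * u = 0")
  case False
  then have "0 < c * u" "c * u \<le> u" using assms by (simp_all add: mult_left_le_one_le order_less_le)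
  then have "log_plus (c * u) \<le> log_plus u" by (rule log_plus_mono)
  then have "c * u * (1 + log_plus (c * u)) \<le> c * u * (1 + log_plus u)"
    using \<open>0 < c * u\<close> by (intro mult_left_mono) auto
  then show ?thesis by (simp only: mult.assoc)
qed (use assms in \<open>auto\<close>)

text \<open>
The convex conjugate of \<open>exp\<close> is \<open>u * (ln u - 1)\<close>, which is at most \<open>\<Phi> u\<close>.
\<close>

lemma Young_\<Phi>_exp:
  assumes "0 \<le> u" "0 \<le> v"
  shows "v * u \<le> \<Phi> u + exp v"
proof (cases "u = 0")
  case False
  then have u: "0 < u" using assms by simp
  have "1 + (v - ln u) \<le> exp (v - ln u)" by (rule exp_ge_add_one_self)
  then have "u * (1 + (v - ln u)) \<le> u * exp (v - ln u)" using u by simp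
  also have "\<dots> = exp v" using u by (simp add: exp_diff)
  finally have "v * u \<le> u * (ln u - 1) + exp v" by (simp add: algebra_simps)
  also have "u * (ln u - 1) \<le> \<Phi> u" using u by (intro mult_left_mono) (auto simp: log_plus_def)
  finally show ?thesis by simp
qed auto

context bounded_oscillation
begin

section \<open>Oscillation and mean values\<close>

lemma second_moment:
  assumes L: "0 < L"
  shows "(\<integral>\<^sup>+ y \<in> cube a L. ennreal ((b y - mean a L)\<^sup>2) \<partial>lebesgue) \<le> ennreal (80 * K\<^sup>2 * L ^ CARD('n))"
proof -
  have pw: "(b y - mean a L)\<^sup>2 \<le> 8 * K\<^sup>2 * exp (\<bar>b y - mean a L\<bar> / (2 * K))" for y
  proof -
    define v where "v = \<bar>b y - mean a L\<bar> / (2 * K)"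
    have v: "0 \<le> v" using K_pos by (simp add: v_def)
    have "v\<^sup>2 \<le> 2 * exp v" using exp_lower_Taylor_quadratic[OF v] v by simp
    then have "4 * K\<^sup>2 * v\<^sup>2 \<le> 4 * K\<^sup>2 * (2 * exp v)" by (intro mult_left_mono) auto
    moreover have "4 * K\<^sup>2 * v\<^sup>2 = (b y - mean a L)\<^sup>2"
      using K_pos by (simp add: v_def power_divide power_mult_distrib)
    ultimately show ?thesis by (simp add: v_def)
  qed
  have "(\<integral>\<^sup>+ y \<in> cube a L. ennreal ((b y - mean a L)\<^sup>2) \<partial>lebesgue)
     \<le> (\<integral>\<^sup>+ y. ennreal (8 * K\<^sup>2) * (ennreal (exp (\<bar>b y - mean a L\<bar> / (2 * K))) * indicator (cube a L) y) \<partial>lebesgue)"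
    by (intro nn_integral_mono)
      (auto simp: indicator_def ennreal_mult''[symmetric] intro!: ennreal_leI pw)
  also have "\<dots> = ennreal (8 * K\<^sup>2) * (\<integral>\<^sup>+ y \<in> cube a L. ennreal (exp (\<bar>b y - mean a L\<bar> / (2 * K))) \<partial>lebesgue)"
    by (rule nn_integral_cmult) auto
  also have "\<dots> \<le> ennreal (8 * K\<^sup>2) * ennreal (10 * L ^ CARD('n))"
    by (intro mult_left_mono John_Nirenberg L) auto
  also have "\<dots> = ennreal (80 * K\<^sup>2 * L ^ CARD('n))"
    using L by (simp add: ennreal_mult''[symmetric] mult_ac)
  finally show ?thesis .
qed

text \<open>
Jensen's inequality for the square.  It is derived from \<open>2 r w \<le> w\<^sup>2 + r\<^sup>2\<close>, which keeps all the terms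
non-negative, as extended integrals require.
\<close>

lemma square_mean_diff_le:
  assumes l: "0 < l" and r: "0 < r" "r \<le> \<bar>mean a l - c\<bar>"
  shows "ennreal (r\<^sup>2 * l ^ CARD('n)) \<le> (\<integral>\<^sup>+ y \<in> cube a l. ennreal ((b y - c)\<^sup>2) \<partial>lebesgue)" (is "_ \<le> ?J")
proof (cases "?J = \<infinity>")
  case False
  then obtain q where q: "0 \<le> q" "?J = ennreal q" by (cases ?J) auto
  define v where "v = l ^ CARD('n)"
  have v: "0 < v" using l by (simp add: v_def)
  have pw: "2 * r * \<bar>b y - c\<bar> \<le> (b y - c)\<^sup>2 + r\<^sup>2" for y
    using sum_squares_bound[of r "\<bar>b y - c\<bar>"] by simp
  have "ennreal (2 * r\<^sup>2 * v) \<le> ennreal (2 * r * (\<bar>mean a l - c\<bar> * v))"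
    using r v by (intro ennreal_leI) (simp add: power2_eq_square)
  also have "\<dots> = ennreal (2 * r) * ennreal (\<bar>mean a l - c\<bar> * v)"
    using v by (intro ennreal_mult'') auto
  also have "\<dots> \<le> ennreal (2 * r) * (\<integral>\<^sup>+ y \<in> cube a l. ennreal \<bar>b y - c\<bar> \<partial>lebesgue)"
    unfolding v_def by (intro mult_left_mono mean_diff_le l) auto
  also have "\<dots> = (\<integral>\<^sup>+ y. ennreal (2 * r) * (ennreal \<bar>b y - c\<bar> * indicator (cube a l) y) \<partial>lebesgue)"
    by (rule nn_integral_cmult[symmetric]) auto
  also have "\<dots> \<le> (\<integral>\<^sup>+ y. ennreal ((b y - c)\<^sup>2) * indicator (cube a l) y + ennreal (r\<^sup>2) * indicator (cube a l) y \<partial>lebesgue)"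
    using pw r by (intro nn_integral_mono)
      (auto simp: indicator_def ennreal_mult''[symmetric] ennreal_plus[symmetric] simp del: ennreal_plus intro!: ennreal_leI)
  also have "\<dots> = ?J + ennreal (r\<^sup>2 * v)"
    using l emeasure_cube[of l a] by (subst nn_integral_add)
      (auto simp: nn_integral_cmult_indicator v_def ennreal_mult'' simp del: emeasure_completion)
  also have "\<dots> = ennreal (q + r\<^sup>2 * v)" using q v by simp
  finally have "2 * r\<^sup>2 * v \<le> q + r\<^sup>2 * v" using q v by (subst (asm) ennreal_le_iff) auto
  then show ?thesis using q unfolding v_def[symmetric] by (simp add: ennreal_leI mult.commute)
qed simp

text \<open>
The constant of \<open>maximal_oscillation_weak_L2\<close>: \<open>80 * K\<^sup>2\<close> bounds the second moment, the factor 4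
comes from halving the level, and the summands \<open>1\<close> and \<open>3 ^ n\<close> belong to its two events.
\<close>

definition D :: real where "D = 320 * (1 + 3 ^ CARD('n)) * K\<^sup>2"

lemma D_pos: "0 < D"
  using K_pos by (auto simp: D_def intro!: mult_pos_pos add_pos_pos)

text \<open>
If \<open>b\<close> is far from its mean over some subcube at \<open>x\<close>, then either \<open>b x\<close> or that mean is far
from the mean over the big cube.  The first event is controlled by the second moment, the second
one by the weak type bound for the square of the oscillation.
\<close>

lemma maximal_oscillation_weak_L2:
  assumes F: "countable F" and L: "0 < L" and r: "0 < r"
    and sub: "\<And>p. p \<in> F \<Longrightarrow> 0 < snd p \<and> cube (fst p) (snd p) \<subseteq> cube a L"
  shows "emeasure lebesgue (\<Union>p\<in>F. {x \<in> cube (fst p) (snd p). r < \<bar>b x - mean (fst p) (snd p)\<bar>})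
     \<le> ennreal (D / r\<^sup>2 * L ^ CARD('n))"
proof -
  define n where "n = CARD('n)"
  let ?h = "\<lambda>y. ennreal ((b y - mean a L)\<^sup>2)"
  let ?A = "level a L (r / 2)"
  define F' where "F' = {p \<in> F. r / 2 < \<bar>mean (fst p) (snd p) - mean a L\<bar>}"
  let ?B = "\<Union>p\<in>F'. cube (fst p) (snd p)"
  have F': "countable F'" using F by (simp add: F'_def)
  have Bm: "?B \<in> sets lebesgue" using F' by (intro sets.countable_UN') auto
  have "(\<Union>p\<in>F. {x \<in> cube (fst p) (snd p). r < \<bar>b x - mean (fst p) (snd p)\<bar>}) \<subseteq> ?A \<union> ?B"
  proof
    fix x assume "x \<in> (\<Union>p\<in>F. {x \<in> cube (fst p) (snd p). r < \<bar>b x - mean (fst p) (snd p)\<bar>})"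
    then obtain p where p: "p \<in> F" "x \<in> cube (fst p) (snd p)" "r < \<bar>b x - mean (fst p) (snd p)\<bar>" by blast
    then have "r / 2 < \<bar>b x - mean a L\<bar> \<or> r / 2 < \<bar>mean (fst p) (snd p) - mean a L\<bar>" by linarith
    then show "x \<in> ?A \<union> ?B" using p sub[OF p(1)] by (auto simp: level_def F'_def)
  qed
  then have "emeasure lebesgue (\<Union>p\<in>F. {x \<in> cube (fst p) (snd p). r < \<bar>b x - mean (fst p) (snd p)\<bar>})
     \<le> emeasure lebesgue (?A \<union> ?B)" using Bm by (intro emeasure_mono) auto
  also have "\<dots> \<le> emeasure lebesgue ?A + emeasure lebesgue ?B" using Bm by (intro emeasure_subadditive) auto
  also have "emeasure lebesgue ?A \<le> ennreal (320 * K\<^sup>2 / r\<^sup>2 * L ^ n)"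
  proof -
    have "ennreal ((r / 2)\<^sup>2) * emeasure lebesgue ?A \<le> (\<integral>\<^sup>+ y \<in> cube a L. ?h y \<partial>lebesgue)"
    proof (rule chebyshev_on_set)
      fix x assume "x \<in> ?A"
      then have "(r / 2)\<^sup>2 \<le> \<bar>b x - mean a L\<bar>\<^sup>2" using r by (intro power_mono) (auto simp: level_def)
      then show "ennreal ((r / 2)\<^sup>2) \<le> ?h x" by (intro ennreal_leI) simp
    qed (auto simp: level_def)
    also note second_moment[OF L]
    finally have "(r / 2)\<^sup>2 * measure lebesgue ?A \<le> 80 * K\<^sup>2 * L ^ n"
      using L K_pos by (simp add: emeasure_eq_measure2 ennreal_mult''[symmetric] n_def)
    then have "measure lebesgue ?A \<le> 320 * K\<^sup>2 / r\<^sup>2 * L ^ n"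
      using r by (simp add: field_simps)
    then show ?thesis by (simp add: emeasure_eq_measure2 ennreal_leI)
  qed
  also have "emeasure lebesgue ?B \<le> ennreal (3 ^ n / (r / 2)\<^sup>2) * (\<integral>\<^sup>+ y \<in> cube a L. ?h y \<partial>lebesgue)"
    unfolding n_def
  proof (rule weak_type_cubes)
    fix p assume "p \<in> F'"
    then show "ennreal ((r / 2)\<^sup>2 * snd p ^ CARD('n)) \<le> (\<integral>\<^sup>+ y \<in> cube (fst p) (snd p). ?h y \<partial>lebesgue)"
      using r sub[of p] by (intro square_mean_diff_le) (auto simp: F'_def)
  qed (use F' r sub in \<open>auto simp: F'_def\<close>)
  also have "\<dots> \<le> ennreal (3 ^ n / (r / 2)\<^sup>2) * ennreal (80 * K\<^sup>2 * L ^ n)"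
    unfolding n_def by (intro mult_left_mono second_moment L) auto
  also have "\<dots> = ennreal (3 ^ n * 320 * K\<^sup>2 / r\<^sup>2 * L ^ n)"
    using L by (simp add: ennreal_mult''[symmetric] power_divide mult_ac)
  also have "ennreal (320 * K\<^sup>2 / r\<^sup>2 * L ^ n) + ennreal (3 ^ n * 320 * K\<^sup>2 / r\<^sup>2 * L ^ n) = ennreal (D / r\<^sup>2 * L ^ n)"
  proof -
    have "D / r\<^sup>2 * L ^ n = 320 * K\<^sup>2 / r\<^sup>2 * L ^ n + 3 ^ n * 320 * K\<^sup>2 / r\<^sup>2 * L ^ n"
      using r by (simp add: D_def n_def field_simps)
    then show ?thesis using L by (simp only:) (subst ennreal_plus, auto)
  qed
  finally show ?thesis by (simp add: n_def add_mono)
qed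

lemma dyadic_level:
  fixes y s :: real
  assumes "0 < y" "y \<le> s"
  obtains k :: nat where "s / 2 ^ (k + 1) < y" "y \<le> s / 2 ^ k"
proof -
  obtain m :: nat where m: "s / y < 2 ^ m" using real_arch_pow[of 2 "s / y"] by auto
  let ?P = "\<lambda>k. s / 2 ^ (k + 1) < y"
  have ex: "?P m" using m assms by (simp add: field_simps)
  define k where "k = (LEAST k. ?P k)"
  have k: "?P k" unfolding k_def using ex by (rule LeastI)
  have "y \<le> s / 2 ^ k"
  proof (cases k)
    case (Suc j)
    then have "\<not> ?P j" unfolding k_def using not_less_Least[of j ?P] by simp
    then show ?thesis by (simp add: Suc)
  qed (use assms in simp)
  with k show ?thesis by (rule that)
qed

text \<open>
If the product of the oscillation and the mean \<open>y\<close> of \<open>h\<close> exceeds \<open>s\<close>, then either \<open>y \<ge> s\<close>,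
or \<open>y\<close> is in the dyadic range between \<open>s / 2 ^ (k + 1)\<close> and \<open>s / 2 ^ k\<close> for some \<open>k\<close>, and the
oscillation exceeds \<open>2 ^ k\<close>.  By the covering estimate and \<open>maximal_oscillation_weak_L2\<close> the
contribution of \<open>k\<close> is of order \<open>2 ^ k / 4 ^ k\<close>, which is summable.
\<close>

lemma oscillation_times_average_weak_type:
  assumes F: "countable F" and s: "0 < s"
    and sub: "\<And>p. p \<in> F \<Longrightarrow> 0 < snd p \<and> cube (fst p) (snd p) \<subseteq> P" and P: "P \<in> sets lebesgue"
    and h [measurable]: "h \<in> borel_measurable lebesgue"
  shows "emeasure lebesgue (\<Union>p\<in>F. {x \<in> cube (fst p) (snd p). ennreal (s * snd p ^ CARD('n))
        < ennreal \<bar>b x - mean (fst p) (snd p)\<bar> * (\<integral>\<^sup>+ y \<in> cube (fst p) (snd p). h y \<partial>lebesgue)})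
     \<le> ennreal (3 ^ CARD('n) * (1 + 4 * D) / s) * (\<integral>\<^sup>+ y \<in> P. h y \<partial>lebesgue)"
    (is "emeasure lebesgue ?Z \<le> _ * ?H")
proof (cases "?H = \<infinity>")
  case True
  have "0 < 3 ^ CARD('n) * (1 + 4 * D) / s" using D_pos s by simp
  then have "ennreal (3 ^ CARD('n) * (1 + 4 * D) / s) \<noteq> 0" by (simp only: ennreal_eq_0_iff not_le)
  then show ?thesis unfolding True infinity_ennreal_def by (simp only: ennreal_mult_top if_False top_greatest)
next
  case False
  note [measurable] = P
  define n where "n = CARD('n)"
  define J where "J p = (\<integral>\<^sup>+ y \<in> cube (fst p) (snd p). h y \<partial>lebesgue)" for p
  have JH: "J p \<le> ?H" if "p \<in> F" for p
    unfolding J_def using sub[OF that] by (intro nn_integral_mono) (auto simp: indicator_def)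
  define F0 where "F0 = {p \<in> F. ennreal (s * snd p ^ n) \<le> J p}"
  define G where "G k = {p \<in> F. ennreal (s / 2 ^ (k + 1) * snd p ^ n) \<le> J p}" for k :: nat
  let ?E = "\<lambda>k p. {x \<in> cube (fst p) (snd p). 2 ^ k < \<bar>b x - mean (fst p) (snd p)\<bar>}"
  let ?Top = "\<Union>p\<in>F0. cube (fst p) (snd p)"
  let ?Lev = "\<lambda>k :: nat. \<Union>p\<in>G k. ?E k p"
  have Em: "?E k p \<in> sets lebesgue" for k p
    using level_measurable[of "fst p" "snd p" "2 ^ k"] by (simp add: level_def)
  have cF0: "countable F0" and cG: "\<And>k. countable (G k)" using F by (auto simp: F0_def G_def)
  have Z0m: "?Top \<in> sets lebesgue" using cF0 by (intro sets.countable_UN') auto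
  have Zkm: "?Lev k \<in> sets lebesgue" for k using cG Em by (intro sets.countable_UN') auto
  have "?Z \<subseteq> ?Top \<union> (\<Union>k. ?Lev k)"
  proof
    fix x assume "x \<in> ?Z"
    then obtain p where p: "p \<in> F" "x \<in> cube (fst p) (snd p)"
      "ennreal (s * snd p ^ n) < ennreal \<bar>b x - mean (fst p) (snd p)\<bar> * J p"
      by (auto simp: J_def n_def)
    have l: "0 < snd p" using sub p by auto
    obtain j where j: "0 \<le> j" "J p = ennreal j"
      using JH[OF p(1)] False by (cases "J p") (auto simp: top_unique)
    define y where "y = j / snd p ^ n"
    have jy: "j = y * snd p ^ n" using l by (simp add: y_def)
    have y0: "0 \<le> y" using j l by (simp add: y_def)
    have "s * snd p ^ n < \<bar>b x - mean (fst p) (snd p)\<bar> * j"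
      using p(3) j s l by (simp add: ennreal_mult''[symmetric] ennreal_less_iff)
    then have sy: "s < \<bar>b x - mean (fst p) (snd p)\<bar> * y"
      using l by (simp add: jy mult.assoc[symmetric])
    show "x \<in> ?Top \<union> (\<Union>k. ?Lev k)"
    proof (cases "s \<le> y")
      case True
      then have "p \<in> F0" using p(1) j l by (simp add: F0_def jy ennreal_leI mult_right_mono)
      then show ?thesis using p(2) by blast
    next
      case nle: False
      have "0 < y" using sy s y0 by (cases "y = 0") auto
      then obtain k where k: "s / 2 ^ (k + 1) < y" "y \<le> s / 2 ^ k"
        using dyadic_level[of y s] nle by auto
      have "s / 2 ^ (k + 1) * snd p ^ n \<le> j"
        unfolding jy using k(1) l by (intro mult_right_mono) auto
      then have "p \<in> G k" using p(1) by (simp only: G_def j(2) mem_Collect_eq ennreal_leI simp_thms)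
      moreover have "2 ^ k < \<bar>b x - mean (fst p) (snd p)\<bar>"
      proof (rule ccontr)
        assume "\<not> ?thesis"
        then have "\<bar>b x - mean (fst p) (snd p)\<bar> * y \<le> 2 ^ k * (s / 2 ^ k)"
          using k(2) y0 by (intro mult_mono) auto
        then show False using sy by simp
      qed
      ultimately show ?thesis using p(2) by blast
    qed
  qed
  then have "emeasure lebesgue ?Z \<le> emeasure lebesgue (?Top \<union> (\<Union>k. ?Lev k))"
    using Z0m Zkm by (intro emeasure_mono) auto
  also have "\<dots> \<le> emeasure lebesgue ?Top + emeasure lebesgue (\<Union>k. ?Lev k)"
    using Z0m Zkm by (intro emeasure_subadditive) auto
  also have "emeasure lebesgue (\<Union>k. ?Lev k) \<le> (\<Sum>k. emeasure lebesgue (?Lev k))"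
    using Zkm by (intro emeasure_subadditive_countably) auto
  also have "\<dots> \<le> (\<Sum>k. ennreal (2 * 3 ^ n * D / s * (1 / 2) ^ k) * ?H)"
  proof (intro suminf_le allI)
    fix k
    define c where "c = 2 * 3 ^ n * D / s * (1 / 2) ^ k"
    have "emeasure lebesgue (?Lev k) \<le> (\<integral>\<^sup>+ y. ennreal c * (h y * indicator P y) \<partial>lebesgue)"
    proof (rule covering_estimate[where a = fst and l = snd])
      fix p assume p: "p \<in> G k"
      then have pF: "p \<in> F" by (simp add: G_def)
      have l: "0 < snd p" using sub[OF pF] by auto
      have "emeasure lebesgue (\<Union>i\<in>{i \<in> G k. cube (fst i) (snd i) \<subseteq> cube (fst p - vec (snd p)) (3 * snd p)}. ?E k i)
        \<le> ennreal (D / (2 ^ k)\<^sup>2 * (3 * snd p) ^ n)"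
        unfolding n_def using F sub l by (intro maximal_oscillation_weak_L2) (auto simp: G_def)
      also have "D / (2 ^ k)\<^sup>2 * (3 * snd p) ^ n = c * (s / 2 ^ (k + 1) * snd p ^ n)"
        using s by (simp add: c_def power_mult_distrib power2_eq_square field_simps)
      also have "ennreal \<dots> = ennreal c * ennreal (s / 2 ^ (k + 1) * snd p ^ n)"
        using s l by (intro ennreal_mult'') auto
      also have "\<dots> \<le> ennreal c * J p"
        using p by (intro mult_left_mono) (auto simp: G_def)
      also have "\<dots> = (\<integral>\<^sup>+ y. ennreal c * (h y * indicator (cube (fst p) (snd p)) y) \<partial>lebesgue)"
        unfolding J_def by (rule nn_integral_cmult[symmetric]) auto
      also have "\<dots> = (\<integral>\<^sup>+ y \<in> cube (fst p) (snd p). ennreal c * (h y * indicator P y) \<partial>lebesgue)"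
        using sub[OF pF] by (intro nn_integral_cong) (auto simp: indicator_def)
      finally show "emeasure lebesgue (\<Union>i\<in>{i \<in> G k. cube (fst i) (snd i) \<subseteq> cube (fst p - vec (snd p)) (3 * snd p)}. ?E k i)
        \<le> (\<integral>\<^sup>+ y \<in> cube (fst p) (snd p). ennreal c * (h y * indicator P y) \<partial>lebesgue)" .
    qed (use cG Em sub in \<open>auto simp: G_def\<close>)
    also have "\<dots> = ennreal c * ?H" by (rule nn_integral_cmult) auto
    finally show "emeasure lebesgue (?Lev k) \<le> ennreal (2 * 3 ^ n * D / s * (1 / 2) ^ k) * ?H" by (simp add: c_def)
  qed auto
  also have "\<dots> = (\<Sum>k. ennreal (2 * 3 ^ n * D / s * (1 / 2) ^ k)) * ?H" by (rule ennreal_suminf_multc)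
  also have "(\<Sum>k. ennreal (2 * 3 ^ n * D / s * (1 / 2) ^ k)) = ennreal (4 * 3 ^ n * D / s)"
  proof -
    have "(\<lambda>k. 2 * 3 ^ n * D / s * (1 / 2) ^ k) sums (2 * 3 ^ n * D / s * 2)"
      using geometric_sums[of "1 / 2 :: real"] by (intro sums_mult) simp
    moreover have "2 * 3 ^ n * D / s * 2 = 4 * 3 ^ n * D / s" by simp
    ultimately have "(\<lambda>k. 2 * 3 ^ n * D / s * (1 / 2) ^ k) sums (4 * 3 ^ n * D / s)" by (simp only:)
    moreover have "0 \<le> 2 * 3 ^ n * D / s * (1 / 2) ^ k" for k :: nat using s D_pos by simp
    ultimately show ?thesis by (rule suminf_ennreal_eq[rotated])
  qed
  also have "emeasure lebesgue ?Top \<le> ennreal (3 ^ n / s) * ?H"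
    unfolding n_def by (rule weak_type_cubes) (use cF0 s sub in \<open>auto simp: F0_def J_def n_def\<close>)
  also have "ennreal (3 ^ n / s) * ?H + ennreal (4 * 3 ^ n * D / s) * ?H = ennreal (3 ^ n * (1 + 4 * D) / s) * ?H"
    using s D_pos by (subst distrib_right[symmetric], subst ennreal_plus[symmetric]) (auto simp: field_simps)
  finally show ?thesis by (simp add: n_def add_mono)
qed

end

section \<open>The commutator on small and on large cubes\<close>

lemma nn_integral_abs_le_\<Phi>:
  fixes f :: "real ^ 'n \<Rightarrow> real"
  assumes A: "0 < A" and [measurable]: "f \<in> borel_measurable lebesgue" "P \<in> sets lebesgue"
  shows "(\<integral>\<^sup>+ y \<in> P. ennreal \<bar>f y\<bar> \<partial>lebesgue) \<le> ennreal A * (\<integral>\<^sup>+ y \<in> P. ennreal (\<Phi> (\<bar>f y\<bar> / A)) \<partial>lebesgue)"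
proof -
  have pw: "\<bar>f y\<bar> \<le> A * \<Phi> (\<bar>f y\<bar> / A)" for y
    using le_\<Phi>[of "\<bar>f y\<bar> / A"] A by (simp add: field_simps)
  have "(\<integral>\<^sup>+ y \<in> P. ennreal \<bar>f y\<bar> \<partial>lebesgue)
     \<le> (\<integral>\<^sup>+ y. ennreal A * (ennreal (\<Phi> (\<bar>f y\<bar> / A)) * indicator P y) \<partial>lebesgue)"
    using A by (intro nn_integral_mono)
      (auto simp: indicator_def ennreal_mult'[symmetric] simp del: times_divide_eq_left intro!: ennreal_leI pw)
  also have "\<dots> = ennreal A * (\<integral>\<^sup>+ y \<in> P. ennreal (\<Phi> (\<bar>f y\<bar> / A)) \<partial>lebesgue)"
    by (rule nn_integral_cmult) measurable
  finally show ?thesis .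
qed

lemma nn_integral_\<Phi>_rescale:
  fixes f :: "real ^ 'n \<Rightarrow> real"
  assumes A: "0 < A" "A \<le> B" and [measurable]: "f \<in> borel_measurable lebesgue" "P \<in> sets lebesgue"
  shows "(\<integral>\<^sup>+ y \<in> P. ennreal (\<Phi> (\<bar>f y\<bar> / B)) \<partial>lebesgue)
     \<le> ennreal (A / B) * (\<integral>\<^sup>+ y \<in> P. ennreal (\<Phi> (\<bar>f y\<bar> / A)) \<partial>lebesgue)"
proof -
  have pw: "\<Phi> (\<bar>f y\<bar> / B) \<le> A / B * \<Phi> (\<bar>f y\<bar> / A)" for y
    using \<Phi>_scale[of "\<bar>f y\<bar> / A" "A / B"] A by simp
  have "(\<integral>\<^sup>+ y \<in> P. ennreal (\<Phi> (\<bar>f y\<bar> / B)) \<partial>lebesgue)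
     \<le> (\<integral>\<^sup>+ y. ennreal (A / B) * (ennreal (\<Phi> (\<bar>f y\<bar> / A)) * indicator P y) \<partial>lebesgue)"
    using A by (intro nn_integral_mono)
      (auto simp: indicator_def ennreal_mult'[symmetric] simp del: times_divide_eq_left intro!: ennreal_leI pw)
  also have "\<dots> = ennreal (A / B) * (\<integral>\<^sup>+ y \<in> P. ennreal (\<Phi> (\<bar>f y\<bar> / A)) \<partial>lebesgue)"
    by (rule nn_integral_cmult) measurable
  finally show ?thesis .
qed

context bounded_oscillation
begin

text \<open>
Duality between \<open>L log L\<close> and exponential integrability: Young's inequality for \<open>\<bar>f y\<bar> / \<beta>\<close> and
the normalized oscillation, whose exponential the John-Nirenberg inequality bounds.
\<close>

lemma generalized_Hoelder:
  assumes l: "0 < l" and \<beta>: "0 < \<beta>" and [measurable]: "f \<in> borel_measurable lebesgue"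
  shows "(\<integral>\<^sup>+ y \<in> cube a l. ennreal (\<bar>b y - mean a l\<bar> * \<bar>f y\<bar>) \<partial>lebesgue)
     \<le> ennreal (2 * K * \<beta>) * ((\<integral>\<^sup>+ y \<in> cube a l. ennreal (\<Phi> (\<bar>f y\<bar> / \<beta>)) \<partial>lebesgue) + ennreal (10 * l ^ CARD('n)))"
proof -
  let ?v = "\<lambda>y. \<bar>b y - mean a l\<bar> / (2 * K)"
  have pw: "\<bar>b y - mean a l\<bar> * \<bar>f y\<bar> \<le> 2 * K * \<beta> * (\<Phi> (\<bar>f y\<bar> / \<beta>) + exp (?v y))" for y
  proof -
    have "?v y * (\<bar>f y\<bar> / \<beta>) \<le> \<Phi> (\<bar>f y\<bar> / \<beta>) + exp (?v y)"
      using \<beta> K_pos by (intro Young_\<Phi>_exp) auto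
    then have "2 * K * \<beta> * (?v y * (\<bar>f y\<bar> / \<beta>)) \<le> 2 * K * \<beta> * (\<Phi> (\<bar>f y\<bar> / \<beta>) + exp (?v y))"
      using \<beta> K_pos by (intro mult_left_mono) auto
    moreover have "2 * K * \<beta> * (?v y * (\<bar>f y\<bar> / \<beta>)) = \<bar>b y - mean a l\<bar> * \<bar>f y\<bar>"
      using \<beta> K_pos by simp
    ultimately show ?thesis by simp
  qed
  have "(\<integral>\<^sup>+ y \<in> cube a l. ennreal (\<bar>b y - mean a l\<bar> * \<bar>f y\<bar>) \<partial>lebesgue)
     \<le> (\<integral>\<^sup>+ y. ennreal (2 * K * \<beta>) * (ennreal (\<Phi> (\<bar>f y\<bar> / \<beta>)) * indicator (cube a l) y
          + ennreal (exp (?v y)) * indicator (cube a l) y) \<partial>lebesgue)"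
  proof (intro nn_integral_mono)
    fix y
    have "ennreal (\<bar>b y - mean a l\<bar> * \<bar>f y\<bar>) \<le> ennreal (2 * K * \<beta> * (\<Phi> (\<bar>f y\<bar> / \<beta>) + exp (?v y)))"
      by (intro ennreal_leI pw)
    also have "\<dots> = ennreal (2 * K * \<beta>) * ennreal (\<Phi> (\<bar>f y\<bar> / \<beta>) + exp (?v y))"
      using \<beta> K_pos by (intro ennreal_mult') auto
    also have "ennreal (\<Phi> (\<bar>f y\<bar> / \<beta>) + exp (?v y)) = ennreal (\<Phi> (\<bar>f y\<bar> / \<beta>)) + ennreal (exp (?v y))"
      using \<beta> by (intro ennreal_plus) auto
    finally show "ennreal (\<bar>b y - mean a l\<bar> * \<bar>f y\<bar>) * indicator (cube a l) y
      \<le> ennreal (2 * K * \<beta>) * (ennreal (\<Phi> (\<bar>f y\<bar> / \<beta>)) * indicator (cube a l) y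
          + ennreal (exp (?v y)) * indicator (cube a l) y)" by (simp add: indicator_def)
  qed
  also have "\<dots> = ennreal (2 * K * \<beta>) * ((\<integral>\<^sup>+ y \<in> cube a l. ennreal (\<Phi> (\<bar>f y\<bar> / \<beta>)) \<partial>lebesgue)
      + (\<integral>\<^sup>+ y \<in> cube a l. ennreal (exp (?v y)) \<partial>lebesgue))"
    by (simp add: nn_integral_add nn_integral_cmult)
  also have "\<dots> \<le> ennreal (2 * K * \<beta>) * ((\<integral>\<^sup>+ y \<in> cube a l. ennreal (\<Phi> (\<bar>f y\<bar> / \<beta>)) \<partial>lebesgue) + ennreal (10 * l ^ CARD('n)))"
    by (intro mult_left_mono add_left_mono John_Nirenberg l) auto
  finally show ?thesis .
qed

lemma commutator_integral_split:
  assumes [measurable]: "f \<in> borel_measurable lebesgue" "Q \<in> sets lebesgue"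
  shows "(\<integral>\<^sup>+ y \<in> Q. ennreal (\<bar>b x - b y\<bar> * \<bar>f y\<bar>) \<partial>lebesgue)
     \<le> ennreal \<bar>b x - m\<bar> * (\<integral>\<^sup>+ y \<in> Q. ennreal \<bar>f y\<bar> \<partial>lebesgue)
        + (\<integral>\<^sup>+ y \<in> Q. ennreal (\<bar>b y - m\<bar> * \<bar>f y\<bar>) \<partial>lebesgue)"
proof -
  have pw: "\<bar>b x - b y\<bar> * \<bar>f y\<bar> \<le> \<bar>b x - m\<bar> * \<bar>f y\<bar> + \<bar>b y - m\<bar> * \<bar>f y\<bar>" for y
  proof -
    have "\<bar>b x - b y\<bar> \<le> \<bar>b x - m\<bar> + \<bar>b y - m\<bar>" by linarith
    then have "\<bar>b x - b y\<bar> * \<bar>f y\<bar> \<le> (\<bar>b x - m\<bar> + \<bar>b y - m\<bar>) * \<bar>f y\<bar>"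
      by (rule mult_right_mono) simp
    then show ?thesis by (simp only: distrib_right)
  qed
  have "(\<integral>\<^sup>+ y \<in> Q. ennreal (\<bar>b x - b y\<bar> * \<bar>f y\<bar>) \<partial>lebesgue)
     \<le> (\<integral>\<^sup>+ y. ennreal \<bar>b x - m\<bar> * (ennreal \<bar>f y\<bar> * indicator Q y)
         + ennreal (\<bar>b y - m\<bar> * \<bar>f y\<bar>) * indicator Q y \<partial>lebesgue)"
  proof (intro nn_integral_mono)
    fix y
    have "ennreal (\<bar>b x - b y\<bar> * \<bar>f y\<bar>) \<le> ennreal (\<bar>b x - m\<bar> * \<bar>f y\<bar> + \<bar>b y - m\<bar> * \<bar>f y\<bar>)"
      by (intro ennreal_leI pw)
    also have "\<dots> = ennreal \<bar>b x - m\<bar> * ennreal \<bar>f y\<bar> + ennreal (\<bar>b y - m\<bar> * \<bar>f y\<bar>)"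
      by (subst ennreal_plus) (auto intro!: ennreal_mult)
    finally show "ennreal (\<bar>b x - b y\<bar> * \<bar>f y\<bar>) * indicator Q y
      \<le> ennreal \<bar>b x - m\<bar> * (ennreal \<bar>f y\<bar> * indicator Q y) + ennreal (\<bar>b y - m\<bar> * \<bar>f y\<bar>) * indicator Q y"
      by (simp add: indicator_def)
  qed
  also have "\<dots> = ennreal \<bar>b x - m\<bar> * (\<integral>\<^sup>+ y \<in> Q. ennreal \<bar>f y\<bar> \<partial>lebesgue)
        + (\<integral>\<^sup>+ y \<in> Q. ennreal (\<bar>b y - m\<bar> * \<bar>f y\<bar>) \<partial>lebesgue)"
    by (simp add: nn_integral_add nn_integral_cmult)
  finally show ?thesis .
qed

text \<open>
Means over nested cubes differ by at most the logarithm of the ratio of their volumes.  With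
\<open>exp m\<close> equal to this ratio, \<open>v \<le> m + exp (v - m)\<close> for the normalized oscillation \<open>v\<close> about the
mean over the large cube, and the factor \<open>exp (- m)\<close> compensates the passage from the mean over
the small cube to that over the large one.
\<close>

lemma mean_comparison:
  assumes sub: "cube a L \<subseteq> cube a' l" and L: "0 < L" "0 < l"
  shows "\<bar>mean a L - mean a' l\<bar> \<le> 2 * K * (ln (l ^ CARD('n) / L ^ CARD('n)) + 10)"
proof -
  define n where "n = CARD('n)"
  define m where "m = ln (l ^ n / L ^ n)"
  have em: "exp (- m) = L ^ n / l ^ n" unfolding m_def using L by (simp add: exp_minus)
  let ?w = "\<lambda>y. \<bar>b y - mean a' l\<bar>"
  have "L ^ n \<le> l ^ n"
    using measure_mono_fmeasurable[OF sub, of lebesgue] L by (simp add: measure_cube n_def)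
  then have m: "0 \<le> m" unfolding m_def using L by simp
  have pw: "?w y \<le> 2 * K * m + 2 * K * (L ^ n / l ^ n) * exp (?w y / (2 * K))" for y
  proof -
    have "?w y / (2 * K) - m \<le> exp (?w y / (2 * K) - m)"
      using exp_ge_add_one_self[of "?w y / (2 * K) - m"] by linarith
    also have "\<dots> = (L ^ n / l ^ n) * exp (?w y / (2 * K))"
      unfolding em[symmetric] exp_add[symmetric] by (simp only: add.commute diff_conv_add_uminus)
    finally have "2 * K * (?w y / (2 * K)) \<le> 2 * K * (m + (L ^ n / l ^ n) * exp (?w y / (2 * K)))"
      using K_pos by (intro mult_left_mono) auto
    then show ?thesis using K_pos by (simp add: distrib_left)
  qed
  have "ennreal (\<bar>mean a L - mean a' l\<bar> * L ^ n) \<le> (\<integral>\<^sup>+ y \<in> cube a L. ennreal (?w y) \<partial>lebesgue)"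
    unfolding n_def by (rule mean_diff_le) fact
  also have "\<dots> \<le> (\<integral>\<^sup>+ y. ennreal (2 * K * m) * indicator (cube a L) y
      + ennreal (2 * K * (L ^ n / l ^ n)) * (ennreal (exp (?w y / (2 * K))) * indicator (cube a' l) y) \<partial>lebesgue)"
  proof (intro nn_integral_mono)
    fix y
    have "ennreal (?w y) \<le> ennreal (2 * K * m + 2 * K * (L ^ n / l ^ n) * exp (?w y / (2 * K)))"
      by (intro ennreal_leI pw)
    also have "\<dots> = ennreal (2 * K * m) + ennreal (2 * K * (L ^ n / l ^ n) * exp (?w y / (2 * K)))"
      using K_pos m L by (intro ennreal_plus) auto
    also have "ennreal (2 * K * (L ^ n / l ^ n) * exp (?w y / (2 * K)))
       = ennreal (2 * K * (L ^ n / l ^ n)) * ennreal (exp (?w y / (2 * K)))"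
      by (rule ennreal_mult'') simp
    finally show "ennreal (?w y) * indicator (cube a L) y \<le> ennreal (2 * K * m) * indicator (cube a L) y
      + ennreal (2 * K * (L ^ n / l ^ n)) * (ennreal (exp (?w y / (2 * K))) * indicator (cube a' l) y)"
      using sub by (auto simp: indicator_def)
  qed
  also have "\<dots> = ennreal (2 * K * m) * emeasure lebesgue (cube a L)
      + ennreal (2 * K * (L ^ n / l ^ n)) * (\<integral>\<^sup>+ y \<in> cube a' l. ennreal (exp (?w y / (2 * K))) \<partial>lebesgue)"
    by (simp add: nn_integral_add nn_integral_cmult nn_integral_cmult_indicator del: emeasure_completion)
  also have "\<dots> \<le> ennreal (2 * K * m) * ennreal (L ^ n) + ennreal (2 * K * (L ^ n / l ^ n)) * ennreal (10 * l ^ n)"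
    using L emeasure_cube[of L a] unfolding n_def
    by (intro add_mono mult_left_mono John_Nirenberg) auto
  also have "\<dots> = ennreal (2 * K * (m + 10) * L ^ n)"
    using L K_pos m by (simp add: ennreal_mult''[symmetric] ennreal_plus[symmetric] field_simps del: ennreal_plus)
  finally have "\<bar>mean a L - mean a' l\<bar> * L ^ n \<le> 2 * K * (m + 10) * L ^ n"
    using L K_pos m by (subst (asm) ennreal_le_iff) auto
  then show ?thesis using L by (simp add: m_def n_def)
qed

text \<open>
The constant of \<open>small_cubes_estimate\<close>: the first term comes from
\<open>oscillation_times_average_weak_type\<close>, the second one from \<open>generalized_Hoelder\<close>.
\<close>

definition C_small :: real where "C_small = 2 * 3 ^ CARD('n) * (1 + 4 * D) + 44 * 3 ^ CARD('n) * K"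

text \<open>
At a point of the exceptional set, one of the two terms of \<open>commutator_integral_split\<close> exceeds half
of the level.  The one with \<open>b x\<close> is handled by \<open>oscillation_times_average_weak_type\<close>.  If the
other one is large, then so is the mean of \<open>\<Phi> (\<bar>f y\<bar> / \<beta>)\<close>, by \<open>generalized_Hoelder\<close>, and the weak
type bound applies to it.
\<close>

lemma small_cubes_estimate:
  assumes F: "countable F" and A: "0 < A" and \<tau>: "0 < \<tau>" and L: "0 < L"
    and sub: "\<And>p. p \<in> F \<Longrightarrow> 0 < snd p \<and> cube (fst p) (snd p) \<subseteq> cube a L"
    and f [measurable]: "f \<in> borel_measurable lebesgue"
    and norm: "(\<integral>\<^sup>+ y \<in> cube a L. ennreal (\<Phi> (\<bar>f y\<bar> / A)) \<partial>lebesgue) \<le> ennreal (L ^ CARD('n))"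
  shows "emeasure lebesgue (\<Union>p\<in>F. {x \<in> cube (fst p) (snd p). ennreal (\<tau> * snd p ^ CARD('n))
        < (\<integral>\<^sup>+ y \<in> cube (fst p) (snd p). ennreal (\<bar>b x - b y\<bar> * \<bar>f y\<bar>) \<partial>lebesgue)})
     \<le> ennreal (C_small * A / \<tau> * L ^ CARD('n))"
    (is "emeasure lebesgue ?Z \<le> _")
proof -
  define n where "n = CARD('n)"
  let ?q = "\<lambda>p :: (real ^ 'n) \<times> real. cube (fst p) (snd p)"
  let ?I = "\<lambda>p. \<integral>\<^sup>+ y \<in> ?q p. ennreal \<bar>f y\<bar> \<partial>lebesgue"
  \<comment> \<open>Chosen such that \<open>2 * K * \<beta> * (1 + 10) = \<tau> / 2\<close>.\<close>
  define \<beta> where "\<beta> = \<tau> / (44 * K)"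
  have \<beta>: "0 < \<beta>" using \<tau> K_pos by (simp add: \<beta>_def)
  define F2 where "F2 = {p \<in> F. ennreal (snd p ^ n) \<le> (\<integral>\<^sup>+ y \<in> ?q p. ennreal (\<Phi> (\<bar>f y\<bar> / \<beta>)) \<partial>lebesgue)}"
  let ?S1 = "\<Union>p\<in>F. {x \<in> ?q p. ennreal (\<tau> / 2 * snd p ^ n) < ennreal \<bar>b x - mean (fst p) (snd p)\<bar> * ?I p}"
  let ?S2 = "\<Union>p\<in>F2. ?q p"
  have cF2: "countable F2" using F by (simp add: F2_def)
  have S2m: "?S2 \<in> sets lebesgue" using cF2 by (intro sets.countable_UN') auto
  have S1m: "?S1 \<in> sets lebesgue"
  proof (intro sets.countable_UN' F image_subsetI)
    fix p
    have "{x \<in> ?q p. ennreal (\<tau> / 2 * snd p ^ n) < ennreal \<bar>b x - mean (fst p) (snd p)\<bar> * ?I p}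
      = ?q p \<inter> {x \<in> space lebesgue. ennreal (\<tau> / 2 * snd p ^ n) < ennreal \<bar>b x - mean (fst p) (snd p)\<bar> * ?I p}" by auto
    also have "\<dots> \<in> sets lebesgue" by measurable
    finally show "{x \<in> ?q p. ennreal (\<tau> / 2 * snd p ^ n) < ennreal \<bar>b x - mean (fst p) (snd p)\<bar> * ?I p} \<in> sets lebesgue" .
  qed
  have "?Z \<subseteq> ?S1 \<union> ?S2"
  proof
    fix x assume "x \<in> ?Z"
    then obtain p where p: "p \<in> F" "x \<in> ?q p"
      "ennreal (\<tau> * snd p ^ n) < (\<integral>\<^sup>+ y \<in> ?q p. ennreal (\<bar>b x - b y\<bar> * \<bar>f y\<bar>) \<partial>lebesgue)"
      unfolding n_def by blast
    define v where "v = snd p ^ n"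
    have l: "0 < snd p" using sub[OF p(1)] by simp
    then have v: "0 < v" by (simp add: v_def)
    let ?O = "\<integral>\<^sup>+ y \<in> ?q p. ennreal (\<bar>b y - mean (fst p) (snd p)\<bar> * \<bar>f y\<bar>) \<partial>lebesgue"
    have split: "ennreal (\<tau> * v) < ennreal \<bar>b x - mean (fst p) (snd p)\<bar> * ?I p + ?O"
      using less_le_trans[OF p(3) commutator_integral_split] by (simp add: v_def)
    show "x \<in> ?S1 \<union> ?S2"
    proof (rule ccontr)
      assume not: "x \<notin> ?S1 \<union> ?S2"
      have "ennreal \<bar>b x - mean (fst p) (snd p)\<bar> * ?I p \<le> ennreal (\<tau> / 2 * v)"
        using not p(1,2) unfolding v_def by (auto simp: not_less)
      moreover have "?O \<le> ennreal (\<tau> / 2 * v)"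
      proof -
        have "p \<notin> F2" using not p(2) by blast
        then have "(\<integral>\<^sup>+ y \<in> ?q p. ennreal (\<Phi> (\<bar>f y\<bar> / \<beta>)) \<partial>lebesgue) \<le> ennreal v"
          using p(1) by (auto simp: F2_def v_def not_le)
        then have "ennreal (2 * K * \<beta>) * ((\<integral>\<^sup>+ y \<in> ?q p. ennreal (\<Phi> (\<bar>f y\<bar> / \<beta>)) \<partial>lebesgue) + ennreal (10 * v))
          \<le> ennreal (2 * K * \<beta>) * (ennreal v + ennreal (10 * v))"
          by (intro mult_left_mono add_right_mono) auto
        also have "ennreal v + ennreal (10 * v) = ennreal (11 * v)"
          using v by (subst ennreal_plus[symmetric]) auto
        also have "ennreal (2 * K * \<beta>) * ennreal (11 * v) = ennreal (2 * K * \<beta> * (11 * v))"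
          using v by (intro ennreal_mult''[symmetric]) auto
        also have "2 * K * \<beta> * (11 * v) = \<tau> / 2 * v" using K_pos by (simp add: \<beta>_def)
        finally show ?thesis
          using generalized_Hoelder[OF l \<beta> f, of "fst p"] unfolding v_def n_def by (rule order_trans[rotated])
      qed
      ultimately have "ennreal \<bar>b x - mean (fst p) (snd p)\<bar> * ?I p + ?O \<le> ennreal (\<tau> / 2 * v) + ennreal (\<tau> / 2 * v)"
        by (rule add_mono)
      also have "\<dots> = ennreal (\<tau> * v)" using v \<tau> by (subst ennreal_plus[symmetric]) auto
      finally show False using split by simp
    qed
  qed
  then have "emeasure lebesgue ?Z \<le> emeasure lebesgue (?S1 \<union> ?S2)"
    using S1m S2m by (intro emeasure_mono) auto
  also have "\<dots> \<le> emeasure lebesgue ?S1 + emeasure lebesgue ?S2"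
    using S1m S2m by (intro emeasure_subadditive) auto
  also have "emeasure lebesgue ?S1 \<le> ennreal (3 ^ n * (1 + 4 * D) / (\<tau> / 2)) * (\<integral>\<^sup>+ y \<in> cube a L. ennreal \<bar>f y\<bar> \<partial>lebesgue)"
    unfolding n_def using F \<tau> sub by (intro oscillation_times_average_weak_type) auto
  also have "\<dots> \<le> ennreal (3 ^ n * (1 + 4 * D) / (\<tau> / 2)) * (ennreal A * ennreal (L ^ n))"
    unfolding n_def
    by (intro mult_left_mono order_trans[OF nn_integral_abs_le_\<Phi>[OF A f] mult_left_mono[OF norm]]) auto
  also have "\<dots> = ennreal (2 * 3 ^ n * (1 + 4 * D) * A / \<tau> * L ^ n)"
    using A L D_pos \<tau> by (simp add: ennreal_mult''[symmetric] mult_ac)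
  also have "emeasure lebesgue ?S2 \<le> ennreal (44 * 3 ^ n * K * A / \<tau> * L ^ n)"
  proof (cases "A \<le> \<beta>")
    case True
    have "emeasure lebesgue ?S2 \<le> ennreal (3 ^ n / 1) * (\<integral>\<^sup>+ y \<in> cube a L. ennreal (\<Phi> (\<bar>f y\<bar> / \<beta>)) \<partial>lebesgue)"
      unfolding n_def
      by (rule weak_type_cubes) (use cF2 sub in \<open>auto simp: F2_def n_def simp del: emeasure_completion\<close>)
    also have "\<dots> \<le> ennreal (3 ^ n / 1) * (ennreal (A / \<beta>) * ennreal (L ^ n))"
      unfolding n_def
      by (intro mult_left_mono order_trans[OF nn_integral_\<Phi>_rescale[OF A True f] mult_left_mono[OF norm]]) auto
    also have "\<dots> = ennreal (44 * 3 ^ n * K * A / \<tau> * L ^ n)"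
      using A L \<tau> K_pos by (simp add: \<beta>_def ennreal_mult''[symmetric] mult_ac)
    finally show ?thesis .
  next
    case False
    have "emeasure lebesgue ?S2 \<le> emeasure lebesgue (cube a L)"
      using sub by (intro emeasure_mono) (auto simp: F2_def)
    also have "\<dots> = ennreal (L ^ n)" using L by (simp only: emeasure_cube n_def less_imp_le)
    also have "\<dots> \<le> ennreal (44 * 3 ^ n * K * A / \<tau> * L ^ n)"
    proof (rule ennreal_leI)
      have "\<tau> \<le> 44 * K * A" using False K_pos by (simp add: \<beta>_def field_simps)
      also have "\<dots> \<le> 3 ^ n * (44 * K * A)" using A K_pos by simp
      finally have "1 \<le> 44 * 3 ^ n * K * A / \<tau>" using \<tau> by (simp add: mult_ac)
      then have "1 * L ^ n \<le> 44 * 3 ^ n * K * A / \<tau> * L ^ n" using L by (intro mult_right_mono) auto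
      then show "L ^ n \<le> 44 * 3 ^ n * K * A / \<tau> * L ^ n" by (simp only: mult_1)
    qed
    finally show ?thesis .
  qed
  also have "ennreal (2 * 3 ^ n * (1 + 4 * D) * A / \<tau> * L ^ n) + ennreal (44 * 3 ^ n * K * A / \<tau> * L ^ n)
     = ennreal (C_small * A / \<tau> * L ^ n)"
    using A L \<tau> K_pos D_pos by (subst ennreal_plus[symmetric]) (auto simp: C_small_def n_def field_simps)
  finally show ?thesis by (simp add: n_def add_mono)
qed

text \<open>
The triple of the cube contains \<open>cube a0 L\<close>, and \<open>mean_comparison\<close> replaces the mean of \<open>b\<close> over
the triple by the mean over \<open>cube a0 L\<close>, so that the bound depends on \<open>x\<close> only through a fixed
function.
\<close>

lemma large_cube_estimate:
  assumes L: "0 < L" "L \<le> l" and x: "x \<in> cube a l" "x \<in> cube a0 L" and A: "0 < A"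
    and f [measurable]: "f \<in> borel_measurable lebesgue"
    and norm: "(\<integral>\<^sup>+ y \<in> cube (a - vec l) (3 * l). ennreal (\<Phi> (\<bar>f y\<bar> / A)) \<partial>lebesgue) \<le> ennreal ((3 * l) ^ CARD('n))"
  shows "(\<integral>\<^sup>+ y \<in> cube a l. ennreal (\<bar>b x - b y\<bar> * \<bar>f y\<bar>) \<partial>lebesgue)
     \<le> ennreal (3 ^ CARD('n) * A * (\<bar>b x - mean a0 L\<bar> + 2 * K * (ln ((3 * l) ^ CARD('n) / L ^ CARD('n)) + 21)) * l ^ CARD('n))"
proof -
  define n where "n = CARD('n)"
  let ?R = "cube (a - vec l) (3 * l)" and ?m = "mean (a - vec l) (3 * l)"
  define v where "v = (3 * l) ^ n"
  have l: "0 < l" using L by simp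
  have v: "0 < v" using l by (simp add: v_def)
  have sub: "cube a0 L \<subseteq> ?R" using x L by (intro cube_subset_triple) auto
  have sub': "cube a l \<subseteq> ?R" using x l by (intro cube_subset_triple) auto
  let ?c = "ln (v / L ^ n)"
  have "\<bar>mean a0 L - ?m\<bar> \<le> 2 * K * (?c + 10)"
    using mean_comparison[OF sub] l L by (simp add: v_def n_def)
  then have bx: "\<bar>b x - ?m\<bar> \<le> \<bar>b x - mean a0 L\<bar> + 2 * K * (?c + 10)" by linarith
  have "(\<integral>\<^sup>+ y \<in> cube a l. ennreal (\<bar>b x - b y\<bar> * \<bar>f y\<bar>) \<partial>lebesgue)
    \<le> (\<integral>\<^sup>+ y \<in> ?R. ennreal (\<bar>b x - b y\<bar> * \<bar>f y\<bar>) \<partial>lebesgue)"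
    using sub' by (intro nn_integral_mono) (auto simp: indicator_def)
  also have "\<dots> \<le> ennreal \<bar>b x - ?m\<bar> * (\<integral>\<^sup>+ y \<in> ?R. ennreal \<bar>f y\<bar> \<partial>lebesgue)
        + (\<integral>\<^sup>+ y \<in> ?R. ennreal (\<bar>b y - ?m\<bar> * \<bar>f y\<bar>) \<partial>lebesgue)"
    by (rule commutator_integral_split) auto
  also have "\<dots> \<le> ennreal \<bar>b x - ?m\<bar> * (ennreal A * ennreal v)
        + ennreal (2 * K * A) * (ennreal v + ennreal (10 * v))"
  proof (intro add_mono mult_left_mono)
    show "(\<integral>\<^sup>+ y \<in> ?R. ennreal \<bar>f y\<bar> \<partial>lebesgue) \<le> ennreal A * ennreal v"
      unfolding n_def v_def
      by (rule order_trans[OF nn_integral_abs_le_\<Phi>[OF A f] mult_left_mono[OF norm]]) auto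
    have "(\<integral>\<^sup>+ y \<in> ?R. ennreal (\<bar>b y - ?m\<bar> * \<bar>f y\<bar>) \<partial>lebesgue)
      \<le> ennreal (2 * K * A) * ((\<integral>\<^sup>+ y \<in> ?R. ennreal (\<Phi> (\<bar>f y\<bar> / A)) \<partial>lebesgue) + ennreal (10 * v))"
      unfolding v_def n_def using l A by (intro generalized_Hoelder) auto
    also have "\<dots> \<le> ennreal (2 * K * A) * (ennreal v + ennreal (10 * v))"
      using norm by (intro mult_left_mono add_right_mono) (auto simp: v_def n_def)
    finally show "(\<integral>\<^sup>+ y \<in> ?R. ennreal (\<bar>b y - ?m\<bar> * \<bar>f y\<bar>) \<partial>lebesgue)
      \<le> ennreal (2 * K * A) * (ennreal v + ennreal (10 * v))" .
  qed auto
  also have "\<dots> = ennreal (A * (\<bar>b x - ?m\<bar> + 2 * K * 11) * v)"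
    using v A K_pos by (simp add: ennreal_mult''[symmetric] ennreal_plus[symmetric] del: ennreal_plus) (simp add: algebra_simps)
  also have "\<dots> \<le> ennreal (A * (\<bar>b x - mean a0 L\<bar> + 2 * K * (?c + 21)) * v)"
    using bx v A by (intro ennreal_leI mult_right_mono mult_left_mono) (auto simp: algebra_simps)
  also have "A * (\<bar>b x - mean a0 L\<bar> + 2 * K * (?c + 21)) * v = 3 ^ n * A * (\<bar>b x - mean a0 L\<bar> + 2 * K * (?c + 21)) * l ^ n"
    by (simp add: v_def power_mult_distrib)
  finally show ?thesis by (simp add: n_def v_def)
qed

end

section \<open>Rational cubes and measurability of the maximal commutator\<close>

lemma less_avg_cube_iff:
  fixes a :: "real ^ 'n"
  assumes l: "0 < l" and c: "0 \<le> c"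
  shows "ennreal c < avg (cube a l) h \<longleftrightarrow> ennreal (c * l ^ CARD('n)) < (\<integral>\<^sup>+ y \<in> cube a l. h y \<partial>lebesgue)"
proof -
  define v where "v = l ^ CARD('n)"
  have v: "0 < v" using l by (simp add: v_def)
  have eq: "avg (cube a l) h = (\<integral>\<^sup>+ y \<in> cube a l. h y \<partial>lebesgue) / ennreal v"
    unfolding avg_def v_def using emeasure_cube[of l a] l by simp
  show ?thesis
  proof (cases "\<integral>\<^sup>+ y \<in> cube a l. h y \<partial>lebesgue")
    case (real r)
    then show ?thesis
      unfolding eq v_def[symmetric] using v c
      by (simp add: divide_ennreal ennreal_less_iff field_simps)
  next
    case top
    then show ?thesis unfolding eq v_def[symmetric] using v by (simp add: ennreal_top_divide)
  qed
qed

lemma avg_cube_le_iff: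
  fixes a :: "real ^ 'n"
  assumes "0 < l" "0 \<le> c"
  shows "avg (cube a l) h \<le> ennreal c \<longleftrightarrow> (\<integral>\<^sup>+ y \<in> cube a l. h y \<partial>lebesgue) \<le> ennreal (c * l ^ CARD('n))"
  using less_avg_cube_iff[OF assms, of a h] by (simp flip: not_less)

definition rational_cubes :: "((real ^ 'n) \<times> real) set" where
  "rational_cubes = (\<lambda>(q, r). (\<chi> i. of_rat (q i), of_rat r)) ` (UNIV \<times> {r. 0 < r})"

lemma countable_rational_cubes: "countable rational_cubes"
  unfolding rational_cubes_def by (intro countable_image countableI_type)

lemma rational_cubes_pos: "p \<in> rational_cubes \<Longrightarrow> 0 < snd p"
  by (auto simp: rational_cubes_def)

text \<open>
The volume can be increased by a factor arbitrarily close to 1, which is why a supremum of means of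
a non-negative function over cubes does not change if only rational cubes are used.
\<close>

lemma rational_cube_outside:
  fixes a :: "real ^ 'n"
  assumes l: "0 < l" and c: "1 < c"
  obtains p where "p \<in> rational_cubes" "cube a l \<subseteq> cube (fst p) (snd p)" "snd p ^ CARD('n) \<le> c * l ^ CARD('n)"
proof -
  define n where "n = CARD('n)"
  have n: "0 < n" by (simp add: n_def)
  have "l < root n c * l" using l c n by simp
  then obtain r where r: "l < of_rat r" "of_rat r < root n c * l"
    using of_rat_dense by blast
  \<comment> \<open>The rational corner may lie anywhere in an interval of length \<open>of_rat r - l\<close> below \<open>a $ i\<close>.\<close>
  have "\<exists>q. a $ i + l - of_rat r < of_rat q \<and> of_rat q < a $ i" for i
    using of_rat_dense[of "a $ i + l - of_rat r" "a $ i"] r by auto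
  then obtain q where q: "\<And>i. a $ i + l - of_rat r < of_rat (q i)" "\<And>i. of_rat (q i) < a $ i"
    by metis
  have r0: "0 < r" using r l by (metis less_trans zero_less_of_rat_iff)
  show ?thesis
  proof (rule that[of "(\<chi> i. of_rat (q i), of_rat r)"])
    show "(\<chi> i. of_rat (q i), of_rat r) \<in> rational_cubes"
      using r0 by (auto simp: rational_cubes_def intro!: image_eqI[of _ _ "(q, r)"])
    show "cube a l \<subseteq> cube (fst (\<chi> i. of_rat (q i), of_rat r)) (snd (\<chi> i. of_rat (q i), of_rat r))"
    proof
      fix x assume x: "x \<in> cube a l"
      have "of_rat (q i) \<le> x $ i \<and> x $ i \<le> of_rat (q i) + of_rat r" for i
        using x q[of i] unfolding mem_cube by (auto dest!: spec[of _ i])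
      then show "x \<in> cube (fst (\<chi> i. of_rat (q i), of_rat r)) (snd (\<chi> i. of_rat (q i), of_rat r))"
        by (simp add: mem_cube)
    qed
    have "(of_rat r :: real) ^ n \<le> (root n c * l) ^ n" using r0 by (intro power_mono) (use r in auto)
    also have "\<dots> = c * l ^ n" using n c by (simp add: power_mult_distrib)
    finally show "snd (\<chi> i. of_rat (q i), of_rat r) ^ CARD('n) \<le> c * l ^ CARD('n)" by (simp add: n_def)
  qed
qed

lemma less_ennreal_between:
  fixes x y :: ennreal
  assumes "x < y"
  obtains t where "x < ennreal t" "ennreal t < y" "0 \<le> t"
proof -
  obtain z where z: "x < z" "z < y" using dense[OF assms] by blast
  then obtain t where "z = ennreal t" "0 \<le> t" by (cases z) auto
  then show ?thesis using that z by blast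
qed

lemma maximal_commutator_eq_rational_SUP:
  fixes b f :: "real ^ 'n \<Rightarrow> real"
  shows "maximal_commutator b f x = (SUP p\<in>{p \<in> rational_cubes. x \<in> cube (fst p) (snd p)}.
     avg (cube (fst p) (snd p)) (\<lambda>y. ennreal (\<bar>b x - b y\<bar> * \<bar>f y\<bar>)))" (is "_ = ?R")
proof (rule antisym)
  let ?h = "\<lambda>y. ennreal (\<bar>b x - b y\<bar> * \<bar>f y\<bar>)"
  show "maximal_commutator b f x \<le> ?R"
    unfolding maximal_commutator_def
  proof (rule SUP_least)
    fix Q :: "(real ^ 'n) set" assume "Q \<in> {Q \<in> cubes. x \<in> Q}"
    then obtain a l where Q: "Q = cube a l" "0 < l" "x \<in> cube a l" by (auto simp: cubes_eq)
    show "avg Q ?h \<le> ?R"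
    proof (rule ccontr)
      assume "\<not> ?thesis"
      then have lt: "?R < avg Q ?h" by simp
      then obtain t where t: "?R < ennreal t" "ennreal t < avg Q ?h" "0 \<le> t"
        by (rule less_ennreal_between)
      \<comment> \<open>A gap between two levels leaves room for enlarging the cube by the factor \<open>t' / t\<close>.\<close>
      obtain t' where t': "ennreal t < ennreal t'" "ennreal t' < avg Q ?h" "0 \<le> t'"
        by (rule less_ennreal_between[OF t(2)])
      show False
      proof (cases "t = 0")
        case True
        have "0 < t'" using t' True by (simp add: ennreal_less_iff)
        obtain p where p: "p \<in> rational_cubes" "cube a l \<subseteq> cube (fst p) (snd p)"
          using rational_cube_outside[of l 2 a] Q(2) by (metis one_less_numeral_iff semiring_norm(76))
        have "0 < (\<integral>\<^sup>+ y \<in> cube a l. ?h y \<partial>lebesgue)"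
          using t(2) less_avg_cube_iff[OF Q(2) t(3), of a ?h] by (simp only: True Q(1) mult_zero_left ennreal_0)
        also have "\<dots> \<le> (\<integral>\<^sup>+ y \<in> cube (fst p) (snd p). ?h y \<partial>lebesgue)"
          using p(2) by (intro nn_integral_mono) (auto simp: indicator_def)
        finally have "ennreal 0 < avg (cube (fst p) (snd p)) ?h"
          using less_avg_cube_iff[OF rational_cubes_pos[OF p(1)] order_refl, of "fst p" ?h]
          by (simp only: mult_zero_left ennreal_0)
        also have "\<dots> \<le> ?R" using p Q(3) by (intro SUP_upper) auto
        finally show False using t(1) True by simp
      next
        case False
        then have c: "1 < t' / t" using t(3) t'(1) by (simp add: ennreal_less_iff)
        obtain p where p: "p \<in> rational_cubes" "cube a l \<subseteq> cube (fst p) (snd p)"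
          "snd p ^ CARD('n) \<le> t' / t * l ^ CARD('n)"
          using rational_cube_outside[OF Q(2) c] by metis
        have "ennreal (t * snd p ^ CARD('n)) \<le> ennreal (t' * l ^ CARD('n))"
          using p(3) False t(3) by (intro ennreal_leI) (simp add: field_simps)
        also have "\<dots> < (\<integral>\<^sup>+ y \<in> cube a l. ?h y \<partial>lebesgue)"
          using t'(2) less_avg_cube_iff[OF Q(2) t'(3), of a ?h] by (simp only: Q(1))
        also have "\<dots> \<le> (\<integral>\<^sup>+ y \<in> cube (fst p) (snd p). ?h y \<partial>lebesgue)"
          using p(2) by (intro nn_integral_mono) (auto simp: indicator_def)
        finally have "ennreal t < avg (cube (fst p) (snd p)) ?h"
          using less_avg_cube_iff[OF rational_cubes_pos[OF p(1)] t(3), of "fst p" ?h] by (simp only:)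
        also have "\<dots> \<le> ?R" using p Q(3) by (intro SUP_upper) auto
        finally show False using t(1) by simp
      qed
    qed
  qed
  show "?R \<le> maximal_commutator b f x"
    unfolding maximal_commutator_def
    by (intro SUP_least SUP_upper) (auto dest: rational_cubes_pos)
qed

lemma sigma_finite_lebesgue: "sigma_finite_measure (lebesgue :: (real ^ 'n) measure)"
proof
  show "\<exists>A. countable A \<and> A \<subseteq> sets (lebesgue :: (real ^ 'n) measure) \<and> \<Union>A = space lebesgue \<and> (\<forall>a\<in>A. emeasure lebesgue a \<noteq> \<infinity>)"
  proof (intro exI[of _ "range (\<lambda>k :: nat. cball (0 :: real ^ 'n) (real k))"] conjI ballI)
    show "\<Union>(range (\<lambda>k :: nat. cball (0 :: real ^ 'n) (real k))) = space lebesgue"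
      using real_arch_simple by auto
    fix S assume "S \<in> range (\<lambda>k :: nat. cball (0 :: real ^ 'n) (real k))"
    then have "S \<in> lmeasurable" by auto
    then show "emeasure lebesgue S \<noteq> \<infinity>" using fmeasurableD2[of S lebesgue] by (simp del: emeasure_completion)
  qed auto
qed

text \<open>
For a fixed cube the mean is measurable in \<open>x\<close> by Tonelli's theorem, and the supremum may be
taken over countably many cubes.
\<close>

lemma maximal_commutator_measurable:
  fixes b f :: "real ^ 'n \<Rightarrow> real"
  assumes [measurable]: "b \<in> borel_measurable lebesgue" "f \<in> borel_measurable lebesgue"
  shows "maximal_commutator b f \<in> borel_measurable lebesgue"
proof -
  interpret sigma_finite_measure "lebesgue :: (real ^ 'n) measure" by (rule sigma_finite_lebesgue)
  let ?A = "\<lambda>p x. avg (cube (fst p) (snd p)) (\<lambda>y. ennreal (\<bar>b x - b y\<bar> * \<bar>f y\<bar>))"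
  have eq: "maximal_commutator b f = (\<lambda>x. SUP p\<in>rational_cubes. indicator (cube (fst p) (snd p)) x * ?A p x)"
  proof
    fix x
    show "maximal_commutator b f x = (SUP p\<in>rational_cubes. indicator (cube (fst p) (snd p)) x * ?A p x)"
      unfolding maximal_commutator_eq_rational_SUP
    proof (rule antisym)
      show "(SUP p\<in>{p \<in> rational_cubes. x \<in> cube (fst p) (snd p)}. ?A p x)
        \<le> (SUP p\<in>rational_cubes. indicator (cube (fst p) (snd p)) x * ?A p x)"
      proof (rule SUP_least)
        fix p assume "p \<in> {p \<in> rational_cubes. x \<in> cube (fst p) (snd p)}"
        then show "?A p x \<le> (SUP p\<in>rational_cubes. indicator (cube (fst p) (snd p)) x * ?A p x)"
          by (intro SUP_upper2[of p]) auto
      qed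
      show "(SUP p\<in>rational_cubes. indicator (cube (fst p) (snd p)) x * ?A p x)
        \<le> (SUP p\<in>{p \<in> rational_cubes. x \<in> cube (fst p) (snd p)}. ?A p x)"
      proof (rule SUP_least)
        fix p :: "(real ^ 'n) \<times> real" assume p: "p \<in> rational_cubes"
        show "indicator (cube (fst p) (snd p)) x * ?A p x
          \<le> (SUP p\<in>{p \<in> rational_cubes. x \<in> cube (fst p) (snd p)}. ?A p x)"
        proof (cases "x \<in> cube (fst p) (snd p)")
          case True
          then show ?thesis using p by (intro SUP_upper2[of p]) auto
        qed simp
      qed
    qed
  qed
  show ?thesis
    unfolding eq avg_def
    by (intro borel_measurable_SUP countable_rational_cubes) measurable
qed

section \<open>Luxemburg norms\<close>

text \<open>
For \<open>t \<le> 1\<close> the weight is at least 1 and there is nothing to prove; for larger \<open>t\<close> it is at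
least \<open>1 / t\<close>.
\<close>

lemma weak_LlogL_norm_le:
  fixes a :: "real ^ 'n"
  assumes L: "0 < L" and \<alpha>: "0 < \<alpha>"
    and tail: "\<And>t. 1 < t \<Longrightarrow> emeasure lebesgue {x \<in> cube a L. ennreal (\<alpha> * t) < g x} \<le> ennreal (L ^ CARD('n) / t)"
  shows "weak_LlogL_norm (cube a L) g \<le> ennreal \<alpha>"
proof -
  define v where "v = L ^ CARD('n)"
  have v: "0 < v" using L by (simp add: v_def)
  have "emeasure lebesgue {x \<in> cube a L. ennreal (\<alpha> * t) < g x} / emeasure lebesgue (cube a L)
      / ennreal (\<Phi> (1 / t)) \<le> 1" if t: "0 < t" for t
  proof -
    have pos: "0 < \<Phi> (1 / t)" using t by (intro mult_pos_pos add_pos_nonneg) auto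
    have "emeasure lebesgue {x \<in> cube a L. ennreal (\<alpha> * t) < g x} \<le> ennreal (v * \<Phi> (1 / t))"
    proof (cases "1 < t")
      case True
      have "1 / t \<le> \<Phi> (1 / t)" using t by (intro le_\<Phi>) auto
      then have "v * (1 / t) \<le> v * \<Phi> (1 / t)" using v by (intro mult_left_mono) auto
      then show ?thesis using tail[OF True] by (auto simp: v_def intro: order_trans ennreal_leI)
    next
      case False
      have "1 \<le> 1 / t" using False t by (simp add: field_simps)
      also have "\<dots> \<le> \<Phi> (1 / t)" using t by (intro le_\<Phi>) auto
      finally have "v * 1 \<le> v * \<Phi> (1 / t)" using v by (intro mult_left_mono) auto
      moreover have "emeasure lebesgue {x \<in> cube a L. ennreal (\<alpha> * t) < g x} \<le> emeasure lebesgue (cube a L)"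
        by (intro emeasure_mono) auto
      moreover have "emeasure lebesgue (cube a L) = ennreal (v * 1)"
        using L emeasure_cube[of L a] by (simp add: v_def)
      moreover have "ennreal (v * 1) \<le> ennreal (v * \<Phi> (1 / t))"
        by (rule ennreal_leI) fact
      ultimately show ?thesis by (metis (no_types, lifting) order_trans)
    qed
    then have "emeasure lebesgue {x \<in> cube a L. ennreal (\<alpha> * t) < g x} / ennreal v / ennreal (\<Phi> (1 / t))
      \<le> ennreal (v * \<Phi> (1 / t)) / ennreal v / ennreal (\<Phi> (1 / t))"
      by (intro divide_right_mono_ennreal)
    also have "\<dots> = 1"
    proof -
      have "ennreal (v * z) / ennreal v / ennreal z = 1" if "0 < z" for z
        using that v by (simp add: divide_ennreal)
      then show ?thesis using pos by blast
    qed
    finally show ?thesis using L emeasure_cube[of L a] by (simp add: v_def)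
  qed
  then show ?thesis
    unfolding weak_LlogL_norm_def using \<alpha> by (intro INF_lower) (auto intro!: SUP_least)
qed

text \<open>
The strict inequality provides an admissible number below the threshold, so it does not matter
whether the infimum in the Luxemburg norm is attained.
\<close>

lemma \<Phi>_integral_le_of_norm_less:
  fixes a :: "real ^ 'n" and f :: "real ^ 'n \<Rightarrow> real"
  assumes l: "0 < l" and N: "zygmund_morrey_norm lam f < ennreal N" and [measurable]: "f \<in> borel_measurable lebesgue"
  shows "(\<integral>\<^sup>+ y \<in> cube a l. ennreal (\<Phi> (\<bar>f y\<bar> / (N * (l ^ CARD('n)) powr - (lam / real CARD('n))))) \<partial>lebesgue)
     \<le> ennreal (l ^ CARD('n))"
proof -
  define v where "v = l ^ CARD('n)"
  define \<theta> where "\<theta> = lam / real CARD('n)"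
  define A where "A = N * v powr - \<theta>"
  have v: "0 < v" using l by (simp add: v_def)
  have N0: "0 < N" using le_less_trans[OF zero_le N] by simp
  have "ennreal (v powr \<theta>) * LlogL_norm (cube a l) f \<le> zygmund_morrey_norm lam f"
    unfolding zygmund_morrey_norm_def
    by (rule SUP_upper2[of "cube a l"]) (use l measure_cube[of l a] in \<open>auto simp: v_def \<theta>_def\<close>)
  then have lt: "ennreal (v powr \<theta>) * LlogL_norm (cube a l) f < ennreal N" using N by (rule le_less_trans)
  have "LlogL_norm (cube a l) f < ennreal A"
  proof (rule ccontr)
    assume "\<not> ?thesis"
    then have "ennreal (v powr \<theta>) * ennreal A \<le> ennreal (v powr \<theta>) * LlogL_norm (cube a l) f"
      by (intro mult_left_mono) auto
    also have "ennreal (v powr \<theta>) * ennreal A = ennreal N"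
      using v N0 by (simp add: A_def ennreal_mult''[symmetric] powr_minus field_simps)
    finally show False using lt by simp
  qed
  then obtain \<alpha> where \<alpha>: "0 < \<alpha>" "avg (cube a l) (\<lambda>x. ennreal (\<Phi> (\<bar>f x\<bar> / \<alpha>))) \<le> 1" "\<alpha> < A"
    unfolding LlogL_norm_def by (auto simp: INF_less_iff ennreal_less_iff)
  have "(\<integral>\<^sup>+ y \<in> cube a l. ennreal (\<Phi> (\<bar>f y\<bar> / A)) \<partial>lebesgue)
    \<le> ennreal (\<alpha> / A) * (\<integral>\<^sup>+ y \<in> cube a l. ennreal (\<Phi> (\<bar>f y\<bar> / \<alpha>)) \<partial>lebesgue)"
    using \<alpha> by (intro nn_integral_\<Phi>_rescale) auto
  also have "\<dots> \<le> ennreal 1 * ennreal v"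
    using \<alpha> avg_cube_le_iff[OF l, of 1 a "\<lambda>x. ennreal (\<Phi> (\<bar>f x\<bar> / \<alpha>))"]
    by (intro mult_mono ennreal_leI) (auto simp: v_def)
  finally show ?thesis by (simp add: A_def v_def \<theta>_def)
qed

context bounded_oscillation
begin

section \<open>From BMO to the commutator bound\<close>

text \<open>
The bound for the logarithmic term of \<open>large_cube_estimate\<close> after it has been absorbed by the
power \<open>- \<theta>\<close> of the ratio of volumes.
\<close>

definition C_large :: "real \<Rightarrow> real" where "C_large \<theta> = 2 * K * (1 / \<theta> + 21)"

text \<open>
Cubes at most as large as \<open>cube a L\<close> and larger ones contribute to two exceptional sets, \<open>?S1\<close>
and \<open>?S2\<close>.  The hypothesis says that \<open>f\<close> has norm at most \<open>N\<close> in the Zygmund-Morrey space, in the form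
of an integral bound on every cube.
\<close>

lemma weak_norm_commutator_le:
  assumes L: "0 < L" and N: "0 < N" and \<theta>: "0 < \<theta>"
    and f [measurable]: "f \<in> borel_measurable lebesgue"
    and norm: "\<And>a l. 0 < l \<Longrightarrow> (\<integral>\<^sup>+ y \<in> cube a l. ennreal (\<Phi> (\<bar>f y\<bar> / (N * (l ^ CARD('n)) powr - \<theta>))) \<partial>lebesgue)
       \<le> ennreal (l ^ CARD('n))"
  shows "weak_LlogL_norm (cube a L) (maximal_commutator b f)
     \<le> ennreal (3 ^ CARD('n) * (C_small + B + C_large \<theta>) * (N * (L ^ CARD('n)) powr - \<theta>))"
proof (rule weak_LlogL_norm_le[OF L])
  define n where "n = CARD('n)"
  define V where "V = L ^ n"
  define A where "A l = N * (l ^ n) powr - \<theta>" for l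
  define C where "C = C_small + B + C_large \<theta>"
  have V: "0 < V" using L by (simp add: V_def)
  have A: "0 < A l" if "0 < l" for l using that N by (simp add: A_def)
  have A_anti: "A l' \<le> A l" if "0 < l" "l \<le> l'" for l l'
    unfolding A_def using that N \<theta> by (intro mult_left_mono powr_mono2' power_mono) auto
  have Cs: "0 < C_small" "0 < C_large \<theta>"
    using D_pos K_pos \<theta> by (auto simp: C_small_def C_large_def intro!: add_pos_pos mult_pos_pos)
  have C: "0 < C" using Cs B_pos by (simp add: C_def)
  show "0 < 3 ^ CARD('n) * (C_small + B + C_large \<theta>) * (N * (L ^ CARD('n)) powr - \<theta>)"
    using C A[OF L] by (simp add: C_def A_def n_def)
  fix t :: real assume t: "1 < t"
  define \<tau> where "\<tau> = 3 ^ n * C * A L * t"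
  have \<tau>: "0 < \<tau>" using C A[OF L] t by (simp add: \<tau>_def)
  let ?P = "cube (a - vec L) (3 * L)"
  define F where "F = {p \<in> rational_cubes. cube (fst p) (snd p) \<subseteq> ?P}"
  have cF: "countable F" unfolding F_def by (rule countable_subset[OF _ countable_rational_cubes]) auto
  let ?J = "\<lambda>p x. \<integral>\<^sup>+ y \<in> cube (fst p) (snd p). ennreal (\<bar>b x - b y\<bar> * \<bar>f y\<bar>) \<partial>lebesgue"
  let ?S1 = "\<Union>p\<in>F. {x \<in> cube (fst p) (snd p). ennreal (\<tau> * snd p ^ CARD('n)) < ?J p x}"
  let ?u = "\<lambda>x. 3 ^ n * A L * (\<bar>b x - mean a L\<bar> + C_large \<theta>)"
  let ?S2 = "{x \<in> cube a L. \<tau> < ?u x}"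
  interpret sigma_finite_measure "lebesgue :: (real ^ 'n) measure" by (rule sigma_finite_lebesgue)
  have S1m: "?S1 \<in> sets lebesgue"
  proof (intro sets.countable_UN' cF image_subsetI)
    fix p
    have "{x \<in> cube (fst p) (snd p). ennreal (\<tau> * snd p ^ CARD('n)) < ?J p x}
      = cube (fst p) (snd p) \<inter> {x \<in> space lebesgue. ennreal (\<tau> * snd p ^ CARD('n)) < ?J p x}" by auto
    also have "\<dots> \<in> sets lebesgue" by measurable
    finally show "{x \<in> cube (fst p) (snd p). ennreal (\<tau> * snd p ^ CARD('n)) < ?J p x} \<in> sets lebesgue" .
  qed
  have S2m: "?S2 \<in> sets lebesgue"
  proof -
    have "?S2 = cube a L \<inter> {x \<in> space lebesgue. \<tau> < ?u x}" by auto
    also have "\<dots> \<in> sets lebesgue" by measurable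
    finally show ?thesis .
  qed
  have "{x \<in> cube a L. ennreal \<tau> < maximal_commutator b f x} \<subseteq> ?S1 \<union> ?S2"
  proof
    fix x assume "x \<in> {x \<in> cube a L. ennreal \<tau> < maximal_commutator b f x}"
    then have x: "x \<in> cube a L" "ennreal \<tau> < maximal_commutator b f x" by auto
    then obtain p where p: "p \<in> rational_cubes" "x \<in> cube (fst p) (snd p)"
      "ennreal \<tau> < avg (cube (fst p) (snd p)) (\<lambda>y. ennreal (\<bar>b x - b y\<bar> * \<bar>f y\<bar>))"
      unfolding maximal_commutator_eq_rational_SUP by (auto simp: less_SUP_iff)
    define l where "l = snd p"
    have l: "0 < l" using rational_cubes_pos[OF p(1)] by (simp add: l_def)
    have J: "ennreal (\<tau> * l ^ n) < ?J p x"
      using p(3) \<tau> l less_avg_cube_iff[of l \<tau> "fst p"] by (simp add: l_def n_def)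
    show "x \<in> ?S1 \<union> ?S2"
    proof (cases "l \<le> L")
      case True
      then have "cube (fst p) (snd p) \<subseteq> ?P" using p(2) x(1) by (intro cube_subset_triple) (auto simp: l_def)
      then have "p \<in> F" using p(1) by (simp add: F_def)
      then show ?thesis using p(2) J unfolding l_def n_def by blast
    next
      case False
      define \<rho> where "\<rho> = (3 * l) ^ n / L ^ n"
      have "L ^ n \<le> (3 * l) ^ n" using False L by (intro power_mono) auto
      then have \<rho>: "1 \<le> \<rho>" using L by (simp add: \<rho>_def)
      \<comment> \<open>The normalization of \<open>f\<close> on the triple, compared with the one on \<open>cube a L\<close>.\<close>
      have AR: "A (3 * l) = A L * \<rho> powr - \<theta>"
      proof -
        have "(3 * l) ^ n = L ^ n * \<rho>" using L by (simp add: \<rho>_def)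
        then show ?thesis using L \<rho> by (simp add: A_def powr_mult)
      qed
      define u where "u = \<bar>b x - mean a L\<bar>"
      have u: "0 \<le> u" by (simp add: u_def)
      have "?J p x \<le> ennreal (3 ^ n * A (3 * l) * (u + 2 * K * (ln \<rho> + 21)) * l ^ n)"
        unfolding u_def \<rho>_def n_def l_def[symmetric]
      proof (rule large_cube_estimate)
        show "(\<integral>\<^sup>+ y \<in> cube (fst p - vec l) (3 * l). ennreal (\<Phi> (\<bar>f y\<bar> / A (3 * l))) \<partial>lebesgue)
          \<le> ennreal ((3 * l) ^ CARD('n))" using norm[of "3 * l"] l unfolding A_def n_def by simp
      qed (use L False x(1) p(2) l A in \<open>auto simp: l_def\<close>)
      then have "ennreal (\<tau> * l ^ n) < ennreal (3 ^ n * A (3 * l) * (u + 2 * K * (ln \<rho> + 21)) * l ^ n)"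
        using J by (rule less_le_trans[rotated])
      then have "\<tau> * l ^ n < 3 ^ n * A (3 * l) * (u + 2 * K * (ln \<rho> + 21)) * l ^ n"
        using \<tau> l by (subst (asm) ennreal_less_iff) auto
      then have "\<tau> < 3 ^ n * A (3 * l) * (u + 2 * K * (ln \<rho> + 21))" using l by simp
      also have "\<dots> = 3 ^ n * A L * (\<rho> powr - \<theta> * (u + 2 * K * (ln \<rho> + 21)))"
        by (simp add: AR)
      also have "\<dots> \<le> 3 ^ n * A L * (u + C_large \<theta>)"
      proof (intro mult_left_mono)
        have le1: "\<rho> powr - \<theta> \<le> 1" using \<rho> \<theta> by (simp add: powr_minus ge_one_powr_ge_zero field_simps)
        have "ln \<rho> \<le> \<rho> powr \<theta> / \<theta>" using \<rho> \<theta> by (rule ln_powr_bound)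
        then have "\<rho> powr - \<theta> * ln \<rho> \<le> \<rho> powr - \<theta> * (\<rho> powr \<theta> / \<theta>)" by (intro mult_left_mono) auto
        also have "\<dots> = 1 / \<theta>" using \<rho> by (simp add: powr_minus field_simps)
        finally have "\<rho> powr - \<theta> * (ln \<rho> + 21) \<le> 1 / \<theta> + 21" using le1 by (simp add: distrib_left)
        then have "2 * K * (\<rho> powr - \<theta> * (ln \<rho> + 21)) \<le> C_large \<theta>"
          unfolding C_large_def using K_pos by (intro mult_left_mono) auto
        moreover have "\<rho> powr - \<theta> * u \<le> u" using le1 u by (simp add: mult_left_le_one_le)
        ultimately show "\<rho> powr - \<theta> * (u + 2 * K * (ln \<rho> + 21)) \<le> u + C_large \<theta>"
          by (simp add: distrib_left mult.left_commute)
      qed (use A[OF L] in auto)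
      finally show ?thesis using x(1) by (simp add: u_def)
    qed
  qed
  note tail_sub = this
  have "emeasure lebesgue ?S1 \<le> ennreal (C_small * A (3 * L) / \<tau> * (3 * L) ^ CARD('n))"
  proof (rule small_cubes_estimate[OF cF _ \<tau>])
    show "(\<integral>\<^sup>+ y \<in> ?P. ennreal (\<Phi> (\<bar>f y\<bar> / A (3 * L))) \<partial>lebesgue) \<le> ennreal ((3 * L) ^ CARD('n))"
      using norm[of "3 * L"] L unfolding A_def n_def by simp
  qed (use L A rational_cubes_pos in \<open>auto simp: F_def\<close>)
  also have "\<dots> \<le> ennreal (3 ^ n * C_small * A L / \<tau> * V)"
  proof (rule ennreal_leI)
    have "C_small * A (3 * L) / \<tau> * (3 ^ n * V) \<le> C_small * A L / \<tau> * (3 ^ n * V)"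
      using A_anti[of L "3 * L"] L Cs \<tau> V by (intro mult_right_mono divide_right_mono mult_left_mono) auto
    then show "C_small * A (3 * L) / \<tau> * (3 * L) ^ CARD('n) \<le> 3 ^ n * C_small * A L / \<tau> * V"
      by (simp add: V_def n_def power_mult_distrib mult_ac)
  qed
  finally have S1_le: "emeasure lebesgue ?S1 \<le> ennreal (3 ^ n * C_small * A L / \<tau> * V)" .
  have S2_le: "emeasure lebesgue ?S2 \<le> ennreal (3 ^ n * A L * (B + C_large \<theta>) / \<tau> * V)"
  proof -
    have S2: "?S2 \<in> lmeasurable" using S2m by (rule lmeasurable_subset_cube) auto
    have "ennreal \<tau> * emeasure lebesgue ?S2 \<le> (\<integral>\<^sup>+ x \<in> cube a L. ennreal (?u x) \<partial>lebesgue)"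
      using S2m by (rule chebyshev_on_set) (auto intro!: ennreal_leI)
    also have "\<dots> = (\<integral>\<^sup>+ x. ennreal (3 ^ n * A L) * (ennreal \<bar>b x - mean a L\<bar> * indicator (cube a L) x
         + ennreal (C_large \<theta>) * indicator (cube a L) x) \<partial>lebesgue)"
    proof (intro nn_integral_cong)
      fix x
      have "ennreal (?u x) = ennreal (3 ^ n * A L) * ennreal (\<bar>b x - mean a L\<bar> + C_large \<theta>)"
        using Cs by (intro ennreal_mult'') auto
      also have "ennreal (\<bar>b x - mean a L\<bar> + C_large \<theta>) = ennreal \<bar>b x - mean a L\<bar> + ennreal (C_large \<theta>)"
        using Cs by (intro ennreal_plus) auto
      finally show "ennreal (?u x) * indicator (cube a L) x = ennreal (3 ^ n * A L) *
          (ennreal \<bar>b x - mean a L\<bar> * indicator (cube a L) x + ennreal (C_large \<theta>) * indicator (cube a L) x)"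
        by (simp add: indicator_def)
    qed
    also have "\<dots> = ennreal (3 ^ n * A L) * ((\<integral>\<^sup>+ x \<in> cube a L. ennreal \<bar>b x - mean a L\<bar> \<partial>lebesgue)
        + ennreal (C_large \<theta>) * emeasure lebesgue (cube a L))"
      by (simp add: nn_integral_add nn_integral_cmult nn_integral_cmult_indicator del: emeasure_completion)
    also have "\<dots> \<le> ennreal (3 ^ n * A L) * (ennreal (B * V) + ennreal (C_large \<theta>) * ennreal V)"
      unfolding V_def n_def using emeasure_cube[of L a] L b_oscillation[OF L, of a]
      by (intro mult_left_mono add_mono) (auto simp del: emeasure_completion)
    also have "\<dots> = ennreal (3 ^ n * A L * ((B + C_large \<theta>) * V))"
    proof -
      have "ennreal (C_large \<theta>) * ennreal V = ennreal (C_large \<theta> * V)" using V by (intro ennreal_mult''[symmetric]) auto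
      moreover have "ennreal (B * V) + ennreal (C_large \<theta> * V) = ennreal ((B + C_large \<theta>) * V)"
        using V B_pos Cs by (subst ennreal_plus[symmetric]) (auto simp: distrib_right)
      ultimately show ?thesis using A[OF L] by (simp only:) (intro ennreal_mult'[symmetric], simp)
    qed
    finally have "ennreal (\<tau> * measure lebesgue ?S2) \<le> ennreal (3 ^ n * A L * ((B + C_large \<theta>) * V))"
      unfolding emeasure_eq_measure2[OF S2] ennreal_mult''[OF measure_nonneg, symmetric] .
    moreover have "0 \<le> 3 ^ n * A L * ((B + C_large \<theta>) * V)"
      using A[OF L] B_pos Cs V by simp
    ultimately have "\<tau> * measure lebesgue ?S2 \<le> 3 ^ n * A L * ((B + C_large \<theta>) * V)"
      by (simp only: ennreal_le_iff)
    then have "measure lebesgue ?S2 \<le> 3 ^ n * A L * (B + C_large \<theta>) / \<tau> * V"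
      using \<tau> by (simp add: pos_le_divide_eq mult_ac)
    then show ?thesis unfolding emeasure_eq_measure2[OF S2] by (rule ennreal_leI)
  qed
  have "emeasure lebesgue {x \<in> cube a L. ennreal \<tau> < maximal_commutator b f x} \<le> emeasure lebesgue (?S1 \<union> ?S2)"
    using tail_sub S1m S2m by (intro emeasure_mono) auto
  also have "\<dots> \<le> emeasure lebesgue ?S1 + emeasure lebesgue ?S2"
    using S1m S2m by (intro emeasure_subadditive) auto
  also have "\<dots> \<le> ennreal (3 ^ n * C_small * A L / \<tau> * V) + ennreal (3 ^ n * A L * (B + C_large \<theta>) / \<tau> * V)"
    by (rule add_mono[OF S1_le S2_le])
  also have "ennreal (3 ^ n * C_small * A L / \<tau> * V) + ennreal (3 ^ n * A L * (B + C_large \<theta>) / \<tau> * V) = ennreal (V / t)"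
  proof -
    have "3 ^ n * C_small * A L / \<tau> * V + 3 ^ n * A L * (B + C_large \<theta>) / \<tau> * V = 3 ^ n * C * A L / \<tau> * V"
      unfolding C_def using \<tau> by (simp add: field_simps)
    also have "\<dots> = V / t" using C A[OF L] t by (simp add: \<tau>_def)
    finally show ?thesis
      using Cs A[OF L] \<tau> V B_pos by (subst ennreal_plus[symmetric]) auto
  qed
  finally show "emeasure lebesgue {x \<in> cube a L.
      ennreal (3 ^ CARD('n) * (C_small + B + C_large \<theta>) * (N * (L ^ CARD('n)) powr - \<theta>) * t) < maximal_commutator b f x}
      \<le> ennreal (L ^ CARD('n) / t)"
    unfolding \<tau>_def C_def A_def V_def n_def .
qed

end

lemma BMO_imp_bounded_oscillation:
  fixes b :: "real ^ 'n \<Rightarrow> real"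
  assumes b: "b \<in> BMO" "b \<in> borel_measurable lebesgue"
  obtains B where "bounded_oscillation b B"
proof
  let ?B = "enn2real (BMO_norm b) + 1"
  show "bounded_oscillation b ?B"
  proof
    show "set_integrable lebesgue (cube a l) b" for a l
      using b(1) unfolding BMO_def locally_integrable_def cube_def by auto
    fix a :: "real ^ 'n" and l :: real assume l: "0 < l"
    have "avg (cube a l) (\<lambda>y. ennreal \<bar>b y - mean_value b (cube a l)\<bar>) \<le> BMO_norm b"
      unfolding BMO_norm_def using l by (intro SUP_upper) auto
    also have "\<dots> \<le> ennreal ?B"
      using b(1) by (cases "BMO_norm b") (auto simp: BMO_def ennreal_leI)
    finally show "(\<integral>\<^sup>+ y \<in> cube a l. ennreal \<bar>b y - mean_value b (cube a l)\<bar> \<partial>lebesgue) \<le> ennreal (?B * l ^ CARD('n))"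
      using avg_cube_le_iff[OF l, of ?B a] by simp
  qed (use b(2) in \<open>auto simp: add_nonneg_pos\<close>)
qed

text \<open>
Used to pass from norms less than \<open>N\<close> to the norm itself; the scale \<open>N\<close> has to be
positive even for functions of norm 0.
\<close>

lemma le_of_forall_greater:
  fixes x y :: ennreal
  assumes c: "0 < c" and le: "\<And>N. y < ennreal N \<Longrightarrow> x \<le> ennreal c * ennreal N"
  shows "x \<le> ennreal c * y"
proof (cases y)
  case (real r)
  show ?thesis
  proof (rule ennreal_le_epsilon)
    fix e :: real assume e: "0 < e"
    have "x \<le> ennreal c * ennreal (r + e / c)"
      using real e c by (intro le) (auto simp: ennreal_less_iff)
    also have "\<dots> = ennreal c * y + ennreal e"
      using real e c by (simp add: ennreal_mult'[symmetric] ennreal_plus[symmetric] distrib_left del: ennreal_plus)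
    finally show "x \<le> ennreal c * y + ennreal e" .
  qed
qed (use c in \<open>simp add: ennreal_mult_top\<close>)

lemma BMO_imp_commutator_bound:
  fixes b :: "real ^ 'n \<Rightarrow> real"
  assumes lam: "0 < lam" and b: "b \<in> BMO" "b \<in> borel_measurable lebesgue"
  obtains c where "0 < c" "\<And>f. f \<in> borel_measurable lebesgue \<Longrightarrow>
     weak_zygmund_morrey_norm lam (maximal_commutator b f) \<le> ennreal c * zygmund_morrey_norm lam f"
proof -
  define \<theta> where "\<theta> = lam / real CARD('n)"
  have \<theta>: "0 < \<theta>" using lam by (simp add: \<theta>_def)
  obtain B where "bounded_oscillation b B" using BMO_imp_bounded_oscillation[OF b] .
  then interpret bounded_oscillation b B .
  define c where "c = 3 ^ CARD('n) * (C_small + B + C_large \<theta>)"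
  have c: "0 < c" using D_pos K_pos \<theta> B_pos
    by (auto simp: c_def C_small_def C_large_def intro!: add_pos_pos mult_pos_pos)
  show ?thesis
  proof (rule that[OF c], rule le_of_forall_greater[OF c])
    fix f :: "real ^ 'n \<Rightarrow> real" and N
    assume f: "f \<in> borel_measurable lebesgue" and N: "zygmund_morrey_norm lam f < ennreal N"
    have N0: "0 < N" using le_less_trans[OF zero_le N] by simp
    show "weak_zygmund_morrey_norm lam (maximal_commutator b f) \<le> ennreal c * ennreal N"
      unfolding weak_zygmund_morrey_norm_def
    proof (rule SUP_least)
      fix Q :: "(real ^ 'n) set" assume "Q \<in> cubes"
      then obtain a l where Q: "Q = cube a l" "0 < l" by (auto simp: cubes_eq)
      define v where "v = l ^ CARD('n)"
      have v: "0 < v" using Q by (simp add: v_def)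
      have "weak_LlogL_norm Q (maximal_commutator b f) \<le> ennreal (c * (N * v powr - \<theta>))"
        unfolding Q(1) c_def v_def
        by (rule weak_norm_commutator_le[OF Q(2) N0 \<theta> f])
          (use \<Phi>_integral_le_of_norm_less[OF _ N f] in \<open>simp add: \<theta>_def\<close>)
      then have "ennreal (v powr \<theta>) * weak_LlogL_norm Q (maximal_commutator b f)
        \<le> ennreal (v powr \<theta>) * ennreal (c * (N * v powr - \<theta>))" by (intro mult_left_mono) auto
      also have "\<dots> = ennreal c * ennreal N"
        using v c N0 by (simp add: ennreal_mult''[symmetric] ennreal_mult'[symmetric] powr_minus field_simps)
      finally show "ennreal (measure lebesgue Q powr (lam / real CARD('n))) * weak_LlogL_norm Q (maximal_commutator b f)
        \<le> ennreal c * ennreal N"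
        using Q measure_cube[of l a] by (simp add: v_def \<theta>_def)
    qed
  qed
qed

section \<open>From the commutator bound to BMO\<close>

text \<open>
On a cube \<open>R\<close> that is \<open>r > 1\<close> times as large as \<open>Q = cube a L\<close>, the norm of the indicator is of order at
most \<open>(1 + log r) / r\<close>, which \<open>r powr - \<theta> / (1 - \<theta>)\<close> dominates because \<open>\<theta> < 1\<close>; the factor
\<open>r powr \<theta>\<close> by which the weight of \<open>R\<close> exceeds that of \<open>Q\<close> is thus compensated.
\<close>

lemma zygmund_morrey_norm_indicator_cube:
  fixes a :: "real ^ 'n"
  assumes L: "0 < L" and \<theta>: "\<theta> = lam / real CARD('n)" "0 < \<theta>" "\<theta> < 1"
  shows "zygmund_morrey_norm lam (indicator (cube a L)) \<le> ennreal ((L ^ CARD('n)) powr \<theta> / (1 - \<theta>))"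
  unfolding zygmund_morrey_norm_def
proof (rule SUP_least)
  define W where "W = L ^ CARD('n)"
  have W: "0 < W" using L by (simp add: W_def)
  let ?f = "indicator (cube a L) :: real ^ 'n \<Rightarrow> real"
  fix R :: "(real ^ 'n) set" assume "R \<in> cubes"
  then obtain a' l where R: "R = cube a' l" "0 < l" by (auto simp: cubes_eq)
  define V where "V = l ^ CARD('n)"
  have V: "0 < V" using R by (simp add: V_def)
  have eR: "emeasure lebesgue R = ennreal V" using R emeasure_cube[of l a'] by (simp add: V_def)
  \<comment> \<open>The integrand is \<open>\<Phi> (1 / \<alpha>)\<close> on the intersection of the two cubes and vanishes elsewhere.\<close>
  have LlogL: "LlogL_norm R ?f \<le> ennreal \<alpha>" if "0 < \<alpha>" "\<Phi> (1 / \<alpha>) * min V W \<le> V" for \<alpha>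
  proof -
    have pos: "0 \<le> \<Phi> (1 / \<alpha>)" using that(1) by (intro mult_nonneg_nonneg) auto
    have "(\<integral>\<^sup>+ y \<in> R. ennreal (\<Phi> (\<bar>?f y\<bar> / \<alpha>)) \<partial>lebesgue)
      = (\<integral>\<^sup>+ y. ennreal (\<Phi> (1 / \<alpha>)) * indicator (R \<inter> cube a L) y \<partial>lebesgue)"
      by (intro nn_integral_cong) (auto simp: indicator_def)
    also have "\<dots> = ennreal (\<Phi> (1 / \<alpha>)) * emeasure lebesgue (R \<inter> cube a L)"
      using R by (intro nn_integral_cmult_indicator) auto
    also have "emeasure lebesgue (R \<inter> cube a L) \<le> ennreal (min V W)"
      using emeasure_mono[of "R \<inter> cube a L" R lebesgue] emeasure_mono[of "R \<inter> cube a L" "cube a L" lebesgue]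
        eR R(1) emeasure_cube[of L a] L by (auto simp: min_def W_def simp del: emeasure_completion)
    also have "ennreal (\<Phi> (1 / \<alpha>)) * ennreal (min V W) = ennreal (\<Phi> (1 / \<alpha>) * min V W)"
      using V W by (intro ennreal_mult''[symmetric]) auto
    also have "\<dots> \<le> ennreal (1 * V)" using that(2) by (intro ennreal_leI) simp
    finally have "(\<integral>\<^sup>+ y \<in> R. ennreal (\<Phi> (\<bar>?f y\<bar> / \<alpha>)) \<partial>lebesgue) \<le> ennreal (1 * V)"
      by (simp add: mult_left_mono)
    then have "avg R (\<lambda>y. ennreal (\<Phi> (\<bar>?f y\<bar> / \<alpha>))) \<le> ennreal 1"
      unfolding R(1) V_def using R(2) by (subst avg_cube_le_iff) auto
    then show ?thesis unfolding LlogL_norm_def using that(1) by (intro INF_lower) auto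
  qed
  have "ennreal (V powr \<theta>) * LlogL_norm R ?f \<le> ennreal (W powr \<theta> / (1 - \<theta>))"
  proof (cases "V \<le> W")
    case True
    have "LlogL_norm R ?f \<le> ennreal 1" using True by (intro LlogL) (auto simp: log_plus_def)
    then have "ennreal (V powr \<theta>) * LlogL_norm R ?f \<le> ennreal (V powr \<theta>) * ennreal 1"
      by (intro mult_left_mono) auto
    also have "\<dots> \<le> ennreal (W powr \<theta> / (1 - \<theta>))"
    proof -
      have "V powr \<theta> \<le> W powr \<theta>" using True V \<theta> by (intro powr_mono2) auto
      also have "\<dots> \<le> W powr \<theta> / (1 - \<theta>)" using \<theta> W by (simp add: field_simps)
      finally show ?thesis by (simp add: ennreal_leI)
    qed
    finally show ?thesis .
  next
    case False
    define r where "r = V / W"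
    have r: "1 < r" using False W by (simp add: r_def)
    define \<alpha> where "\<alpha> = r powr - \<theta> / (1 - \<theta>)"
    have \<alpha>: "0 < \<alpha>" using r \<theta> by (simp add: \<alpha>_def)
    have inv: "1 / \<alpha> = (1 - \<theta>) * r powr \<theta>" using r \<theta> by (simp add: \<alpha>_def powr_minus field_simps)
    have "ln (1 / \<alpha>) \<le> ln (r powr \<theta>)"
      unfolding inv using r \<theta> by (subst ln_le_cancel_iff) (auto simp: mult_left_le_one_le)
    moreover have "0 \<le> \<theta> * ln r" using r \<theta>(2) by (intro mult_nonneg_nonneg) auto
    ultimately have "log_plus (1 / \<alpha>) \<le> \<theta> * ln r" using r \<theta>(2) by (simp add: log_plus_def ln_powr)
    also have "\<dots> \<le> \<theta> * (r powr (1 - \<theta>) / (1 - \<theta>))"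
      using r \<theta> by (intro mult_left_mono ln_powr_bound) auto
    finally have "\<Phi> (1 / \<alpha>) \<le> (1 - \<theta>) * r powr \<theta> * (1 + \<theta> * (r powr (1 - \<theta>) / (1 - \<theta>)))"
      unfolding inv using \<theta> by (intro mult_left_mono) auto
    also have "\<dots> = (1 - \<theta>) * r powr \<theta> + \<theta> * (r powr \<theta> * r powr (1 - \<theta>))"
      using \<theta> by (simp add: field_simps)
    also have "\<dots> \<le> (1 - \<theta>) * r + \<theta> * r"
    proof -
      have "r powr \<theta> \<le> r powr 1" using r \<theta> by (intro powr_mono) auto
      moreover have "r powr \<theta> * r powr (1 - \<theta>) = r" using r by (simp flip: powr_add)
      ultimately show ?thesis using r \<theta> by (intro add_mono mult_left_mono) auto
    qed
    also have "\<dots> = r" by (simp add: algebra_simps)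
    finally have "\<Phi> (1 / \<alpha>) * W \<le> r * W" using W by (intro mult_right_mono) auto
    then have "\<Phi> (1 / \<alpha>) * min V W \<le> V" using False W by (simp add: r_def)
    then have "LlogL_norm R ?f \<le> ennreal \<alpha>" using \<alpha> by (intro LlogL)
    then have "ennreal (V powr \<theta>) * LlogL_norm R ?f \<le> ennreal (V powr \<theta>) * ennreal \<alpha>"
      by (intro mult_left_mono) auto
    also have "\<dots> = ennreal (V powr \<theta> * \<alpha>)" using \<alpha> by (intro ennreal_mult''[symmetric]) auto
    also have "V powr \<theta> * \<alpha> = W powr \<theta> / (1 - \<theta>)"
      using V W by (simp add: \<alpha>_def r_def powr_minus powr_divide)
    finally show ?thesis .
  qed
  then show "ennreal (measure lebesgue R powr (lam / real CARD('n))) * LlogL_norm R ?f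
     \<le> ennreal ((L ^ CARD('n)) powr \<theta> / (1 - \<theta>))"
    using R measure_cube[of l a'] \<theta>(1) by (simp add: V_def W_def)
qed

lemma BMO_if_oscillation_about_constants:
  fixes b :: "real ^ 'n \<Rightarrow> real"
  assumes [measurable]: "b \<in> borel_measurable lebesgue" and M: "0 \<le> M"
    and osc: "\<And>a l. 0 < l \<Longrightarrow> \<exists>m. (\<integral>\<^sup>+ y \<in> cube a l. ennreal \<bar>b y - m\<bar> \<partial>lebesgue) \<le> ennreal (M * l ^ CARD('n))"
  shows "b \<in> BMO"
proof -
  have triangle: "(\<integral>\<^sup>+ y \<in> cube a l. ennreal \<bar>b y - c\<bar> \<partial>lebesgue)
     \<le> (\<integral>\<^sup>+ y \<in> cube a l. ennreal \<bar>b y - m\<bar> \<partial>lebesgue) + ennreal (\<bar>m - c\<bar> * l ^ CARD('n))"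
    if l: "0 < l" for a :: "real ^ 'n" and l m c
  proof -
    have "(\<integral>\<^sup>+ y \<in> cube a l. ennreal \<bar>b y - c\<bar> \<partial>lebesgue)
     \<le> (\<integral>\<^sup>+ y. ennreal \<bar>b y - m\<bar> * indicator (cube a l) y + ennreal \<bar>m - c\<bar> * indicator (cube a l) y \<partial>lebesgue)"
    proof (intro nn_integral_mono)
      fix y
      have "ennreal \<bar>b y - c\<bar> \<le> ennreal (\<bar>b y - m\<bar> + \<bar>m - c\<bar>)" by (intro ennreal_leI) linarith
      also have "\<dots> = ennreal \<bar>b y - m\<bar> + ennreal \<bar>m - c\<bar>" by (intro ennreal_plus) auto
      finally show "ennreal \<bar>b y - c\<bar> * indicator (cube a l) y
        \<le> ennreal \<bar>b y - m\<bar> * indicator (cube a l) y + ennreal \<bar>m - c\<bar> * indicator (cube a l) y"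
        by (simp add: indicator_def)
    qed
    also have "\<dots> = (\<integral>\<^sup>+ y \<in> cube a l. ennreal \<bar>b y - m\<bar> \<partial>lebesgue) + ennreal (\<bar>m - c\<bar> * l ^ CARD('n))"
      using l emeasure_cube[of l a]
      by (simp add: nn_integral_add nn_integral_cmult_indicator ennreal_mult'' del: emeasure_completion)
    finally show ?thesis .
  qed
  have int: "set_integrable lebesgue (cube a l) b" if l: "0 < l" for a l
  proof -
    obtain m where m: "(\<integral>\<^sup>+ y \<in> cube a l. ennreal \<bar>b y - m\<bar> \<partial>lebesgue) \<le> ennreal (M * l ^ CARD('n))"
      using osc[OF l] by blast
    have "(\<integral>\<^sup>+ y. ennreal (norm (indicator (cube a l) y *\<^sub>R b y)) \<partial>lebesgue) = (\<integral>\<^sup>+ y \<in> cube a l. ennreal \<bar>b y - 0\<bar> \<partial>lebesgue)"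
      by (intro nn_integral_cong) (auto simp: indicator_def)
    also have "\<dots> \<le> ennreal (M * l ^ CARD('n)) + ennreal (\<bar>m - 0\<bar> * l ^ CARD('n))"
      using triangle[OF l, of 0 a m] m by (meson add_right_mono order_trans)
    also have "\<dots> < \<infinity>" by simp
    finally show ?thesis unfolding set_integrable_def by (intro integrableI_bounded) auto
  qed
  have "avg Q (\<lambda>y. ennreal \<bar>b y - mean_value b Q\<bar>) \<le> ennreal (2 * M)" if Q_cube: "Q \<in> cubes" for Q :: "(real ^ 'n) set"
  proof -
    obtain a l where Q: "Q = cube a l" "0 < l" using Q_cube by (auto simp: cubes_eq)
    obtain m where m: "(\<integral>\<^sup>+ y \<in> cube a l. ennreal \<bar>b y - m\<bar> \<partial>lebesgue) \<le> ennreal (M * l ^ CARD('n))"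
      using osc[OF Q(2)] by blast
    have "ennreal (\<bar>mean_value b (cube a l) - m\<bar> * l ^ CARD('n)) \<le> ennreal (M * l ^ CARD('n))"
      by (rule order_trans[OF mean_value_diff_le[OF Q(2) int[OF Q(2)]] m])
    then have "(\<integral>\<^sup>+ y \<in> cube a l. ennreal \<bar>b y - mean_value b (cube a l)\<bar> \<partial>lebesgue)
      \<le> ennreal (M * l ^ CARD('n)) + ennreal (M * l ^ CARD('n))"
      by (intro order_trans[OF triangle[OF Q(2), of _ a m]] add_mono m) (simp add: abs_minus_commute)
    also have "\<dots> = ennreal (2 * M * l ^ CARD('n))"
      using M Q(2) by (subst ennreal_plus[symmetric]) auto
    finally show ?thesis using M Q by (simp add: avg_cube_le_iff)
  qed
  then have "BMO_norm b \<le> ennreal (2 * M)" unfolding BMO_norm_def by (rule SUP_least)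
  then have "BMO_norm b < \<infinity>" by (metis ennreal_less_top infinity_ennreal_def le_less_trans)
  moreover have "locally_integrable b"
    unfolding locally_integrable_def
  proof (intro allI impI)
    fix S :: "(real ^ 'n) set" assume S: "compact S"
    obtain r where r: "0 < r" "\<And>x. x \<in> S \<Longrightarrow> norm x \<le> r"
      using compact_imp_bounded[OF S] bounded_pos by metis
    have "S \<subseteq> cube (- vec r) (2 * r)"
    proof
      fix x assume x: "x \<in> S"
      have "- r \<le> x $ i \<and> x $ i \<le> r" for i
        using component_le_norm_cart[of x i] r(2)[OF x] by linarith
      then show "x \<in> cube (- vec r) (2 * r)" by (simp add: mem_cube)
    qed
    then show "set_integrable lebesgue S b"
      using S r(1) by (intro set_integrable_subset[OF int[of "2 * r" "- vec r"]])
        (simp_all add: lmeasurable_compact fmeasurableD)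
  qed
  ultimately show ?thesis by (simp add: BMO_def)
qed

text \<open>
The level 4 makes the exceptional set at most a quarter of the cube, so some point of the cube lies
outside it.
\<close>

lemma commutator_bound_imp_BMO:
  fixes b :: "real ^ 'n \<Rightarrow> real"
  assumes lam: "0 < lam" "lam < real CARD('n)" and b [measurable]: "b \<in> borel_measurable lebesgue" and c: "0 < c"
    and bound: "\<And>f. f \<in> zygmund_morrey lam \<Longrightarrow>
      weak_zygmund_morrey_norm lam (maximal_commutator b f) \<le> ennreal c * zygmund_morrey_norm lam f"
  shows "b \<in> BMO"
proof -
  define \<theta> where "\<theta> = lam / real CARD('n)"
  have \<theta>: "0 < \<theta>" "\<theta> < 1" using lam by (simp_all add: \<theta>_def)
  define M where "M = c / (1 - \<theta>) + 1"
  have M: "0 < M" using c \<theta> by (simp add: M_def add_pos_pos)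
  show ?thesis
  proof (rule BMO_if_oscillation_about_constants[OF b, of "4 * M"])
    fix a :: "real ^ 'n" and l :: real assume l: "0 < l"
    define v where "v = l ^ CARD('n)"
    have v: "0 < v" using l by (simp add: v_def)
    let ?Q = "cube a l"
    let ?f = "indicator ?Q :: real ^ 'n \<Rightarrow> real"
    let ?C = "maximal_commutator b ?f"
    have nf: "zygmund_morrey_norm lam ?f \<le> ennreal (v powr \<theta> / (1 - \<theta>))"
      unfolding v_def by (rule zygmund_morrey_norm_indicator_cube) (use l \<theta> \<theta>_def in auto)
    have f: "?f \<in> zygmund_morrey lam"
      unfolding zygmund_morrey_def using le_less_trans[OF nf ennreal_less_top] by simp
    have "ennreal (v powr \<theta>) * weak_LlogL_norm ?Q ?C \<le> weak_zygmund_morrey_norm lam ?C"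
      unfolding weak_zygmund_morrey_norm_def
      by (rule SUP_upper2[of ?Q]) (use l measure_cube[of l a] in \<open>auto simp: v_def \<theta>_def\<close>)
    also have "\<dots> \<le> ennreal c * ennreal (v powr \<theta> / (1 - \<theta>))"
      by (intro order_trans[OF bound[OF f]] mult_left_mono nf) auto
    also have "\<dots> = ennreal (v powr \<theta> * (M - 1))"
      using \<theta> c by (simp add: ennreal_mult''[symmetric] M_def field_simps)
    finally have up: "ennreal (v powr \<theta>) * weak_LlogL_norm ?Q ?C \<le> ennreal (v powr \<theta> * (M - 1))" .
    have "weak_LlogL_norm ?Q ?C < ennreal M"
    proof (rule ccontr)
      assume "\<not> ?thesis"
      then have "ennreal (v powr \<theta>) * ennreal M \<le> ennreal (v powr \<theta>) * weak_LlogL_norm ?Q ?C"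
        by (intro mult_left_mono) auto
      then have "ennreal (v powr \<theta> * M) \<le> ennreal (v powr \<theta> * (M - 1))"
        using up M by (simp add: ennreal_mult'')
      then have "v powr \<theta> * M \<le> v powr \<theta> * (M - 1)"
        using c \<theta> by (subst (asm) ennreal_le_iff) (auto simp: M_def)
      then show False using v by simp
    qed
    then obtain \<alpha> where \<alpha>: "0 < \<alpha>" "\<alpha> < M"
      and sup: "(SUP t\<in>{t::real. 0 < t}. emeasure lebesgue {x \<in> ?Q. ennreal (\<alpha> * t) < ?C x} / emeasure lebesgue ?Q
             / ennreal (1 / t * (1 + log_plus (1 / t)))) \<le> 1"
      unfolding weak_LlogL_norm_def by (auto simp: INF_less_iff ennreal_less_iff)
    let ?S = "{x \<in> ?Q. ennreal (\<alpha> * 4) < ?C x}"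
    have eQ: "emeasure lebesgue ?Q = ennreal v" using l emeasure_cube[of l a] by (simp add: v_def)
    have lp: "log_plus (1 / 4) = 0" by (simp add: log_plus_def)
    have "emeasure lebesgue ?S / ennreal v / ennreal (1 / 4) \<le> 1"
      using SUP_le_iff[THEN iffD1, OF sup, rule_format, of 4] by (simp only: eQ lp) simp
    moreover have "?S \<noteq> ?Q"
    proof
      assume "?S = ?Q"
      then have "ennreal v / ennreal v / ennreal (1 / 4) \<le> 1" using calculation eQ by simp
      also have "ennreal v / ennreal v / ennreal (1 / 4) = ennreal 4"
        using v divide_ennreal[of 1 "1 / 4"] by (simp add: divide_ennreal)
      finally show False by simp
    qed
    ultimately obtain x where x: "x \<in> ?Q" "?C x \<le> ennreal (\<alpha> * 4)" by fastforce
    have "avg ?Q (\<lambda>y. ennreal (\<bar>b x - b y\<bar> * \<bar>?f y\<bar>)) \<le> ?C x"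
      unfolding maximal_commutator_def using x(1) l by (intro SUP_upper) auto
    also have "\<dots> \<le> ennreal (4 * M)" using x(2) \<alpha> by (auto intro: order_trans ennreal_leI)
    finally have "(\<integral>\<^sup>+ y \<in> ?Q. ennreal (\<bar>b x - b y\<bar> * \<bar>?f y\<bar>) \<partial>lebesgue) \<le> ennreal (4 * M * l ^ CARD('n))"
      using M l by (subst (asm) avg_cube_le_iff) auto
    also have "(\<integral>\<^sup>+ y \<in> ?Q. ennreal (\<bar>b x - b y\<bar> * \<bar>?f y\<bar>) \<partial>lebesgue) = (\<integral>\<^sup>+ y \<in> ?Q. ennreal \<bar>b y - b x\<bar> \<partial>lebesgue)"
      by (intro nn_integral_cong) (auto simp: indicator_def abs_minus_commute)
    finally show "\<exists>m. (\<integral>\<^sup>+ y \<in> ?Q. ennreal \<bar>b y - m\<bar> \<partial>lebesgue) \<le> ennreal (4 * M * l ^ CARD('n))" by blast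
  qed (use M in simp)
qed

section \<open>The characterization of BMO\<close>

theorem theorem7p1:
  fixes b :: "real ^ 'n \<Rightarrow> real" and lam :: real
  assumes "0 < lam" and "lam < real CARD('n)"
    and "b \<in> borel_measurable lebesgue"
  shows "b \<in> BMO \<longleftrightarrow>
    (\<exists>c::real. 0 < c \<and>
      (\<forall>f \<in> zygmund_morrey lam.
         maximal_commutator b f \<in> weak_zygmund_morrey lam \<and>
         weak_zygmund_morrey_norm lam (maximal_commutator b f)
           \<le> ennreal c * zygmund_morrey_norm lam f))"
proof
  assume "b \<in> BMO"
  then obtain c where c: "0 < c" "\<And>f. f \<in> borel_measurable lebesgue \<Longrightarrow>
     weak_zygmund_morrey_norm lam (maximal_commutator b f) \<le> ennreal c * zygmund_morrey_norm lam f"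
    using BMO_imp_commutator_bound[OF assms(1) _ assms(3)] by blast
  show "\<exists>c::real. 0 < c \<and> (\<forall>f \<in> zygmund_morrey lam.
         maximal_commutator b f \<in> weak_zygmund_morrey lam \<and>
         weak_zygmund_morrey_norm lam (maximal_commutator b f) \<le> ennreal c * zygmund_morrey_norm lam f)"
  proof (intro exI[of _ c] conjI ballI c(1))
    fix f :: "real ^ 'n \<Rightarrow> real" assume "f \<in> zygmund_morrey lam"
    then have f: "f \<in> borel_measurable lebesgue" "zygmund_morrey_norm lam f < \<infinity>"
      by (auto simp: zygmund_morrey_def)
    show le: "weak_zygmund_morrey_norm lam (maximal_commutator b f) \<le> ennreal c * zygmund_morrey_norm lam f"
      by (rule c(2)[OF f(1)])
    also have "\<dots> < \<infinity>" using f(2) by (simp add: ennreal_mult_less_top)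
    finally show "maximal_commutator b f \<in> weak_zygmund_morrey lam"
      using maximal_commutator_measurable[OF assms(3) f(1)] by (simp add: weak_zygmund_morrey_def)
  qed
next
  assume "\<exists>c::real. 0 < c \<and> (\<forall>f \<in> zygmund_morrey lam.
         maximal_commutator b f \<in> weak_zygmund_morrey lam \<and>
         weak_zygmund_morrey_norm lam (maximal_commutator b f) \<le> ennreal c * zygmund_morrey_norm lam f)"
  then show "b \<in> BMO"
    using commutator_bound_imp_BMO[OF assms] by blast
qed

end
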